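(* Let $(\gamma,\sigma)\in S_1\cup S_2$, where $S_1=\,]0,+\infty[\,\times\,]-1,0]$ and $S_2=\,]0,1/2]\,\times\,]-1,+\infty[$. Let $\mathcal{H}$ be a separable infinite-dimensional complex Hilbert space with orthonormal basis $\{|\psi_n\rangle\}_{n\ge0}$, and for $z\in\mathbb{C}$ let $$|z,\gamma,\sigma\rangle=\left(\mathcal{N}_{\gamma,\sigma}(z\bar z)\right)^{-1/2}\sum_{n=0}^{\infty}\sqrt{\frac{n!}{(2\gamma)_n}}\,\frac{\bar z^{\,n}}{(\sigma+1)_n}\,|\psi_n\rangle,\qquad \mathcal{N}_{\gamma,\sigma}(z\bar z)={}_{2}F_{3}\left(\begin{array}{c}1,1\\ 2\gamma,\sigma+1,\sigma+1\end{array}\Big\vert\, z\bar z\right).$$ Then these states satisfy the resolution of the identity $$\int_{\mathbb{C}}|z,\gamma,\sigma\rangle\langle z,\gamma,\sigma|\,d\vartheta_{\gamma,\sigma}(z)=I_{\mathcal{H}},$$ where $I_{\mathcal H}$ is the identity operator of $\mathcal{H}$ and $d\vartheta_{\gamma,\sigma}$ is the measure on $\mathbb{C}$ given by $$d\vartheta_{\gamma,\sigma}(z)=\frac{2}{\Gamma(2\gamma)\Gamma^2(\sigma+1)}\;{}_{2}F_{3}\left(\begin{array}{c}1,1\\ 2\gamma,\sigma+1,\sigma+1\end{array}\Big\vert\, z\bar z\right)\,G^{30}_{13}\left(z\bar z\,\Big\vert\,\begin{array}{c}0\\ 2\gamma-1,\sigma,\sigma\end{array}\right)d\varrho(z),$$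 with $d\varrho(z)=\frac{1}{2\pi}\rho\,d\rho\,d\theta$ for $z=\rho e^{i\theta}$, $\rho>0$, $\theta\in[0,2\pi)$.
   Context: $(a)_0=1$, $(a)_n=a(a+1)\cdots(a+n-1)$. ${}_{2}F_{3}\left(\begin{array}{c}a_1,a_2\\ b_1,b_2,b_3\end{array}\Big\vert x\right)=\sum_{n\ge0}\frac{(a_1)_n(a_2)_n}{(b_1)_n(b_2)_n(b_3)_n}\frac{x^n}{n!}$. The operator-valued integral is understood in the weak sense: $\int_{\mathbb{C}}\langle f|z,\gamma,\sigma\rangle\langle z,\gamma,\sigma|g\rangle\,d\vartheta_{\gamma,\sigma}(z)=\langle f|g\rangle$ for all $f,g\in\mathcal{H}$. The Meijer G-function used here is, for $r>0$, $$G^{30}_{13}\left(r\,\Big\vert\,\begin{array}{c}a_1\\ b_1,b_2,b_3\end{array}\right)=\frac{1}{2\pi i}\int_{c-i\infty}^{c+i\infty}\frac{\Gamma(b_1+s)\Gamma(b_2+s)\Gamma(b_3+s)}{\Gamma(a_1+s)}\,r^{-s}\,ds,$$ with real $c>\max_j(-\Re b_j)$; equivalently it is the function of $r>0$ whose Mellin transform is $\frac{\Gamma(b_1+s)\Gamma(b_2+s)\Gamma(b_3+s)}{\Gamma(a_1+s)}$. *)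

theory Defs
  imports "HOL-Analysis.Analysis"
begin

class scaleC =
  fixes scaleC :: "complex \<Rightarrow> 'a \<Rightarrow> 'a"  (infixr "*\<^sub>C" 75)

(* The inner product is conjugate-linear in its first argument, as in bra-ket notation.
   Completeness and the metric structure come from class banach; the last axiom says that the
   norm is the one induced by the inner product (so the inner product is positive definite). *)
class complex_hilbert_space = banach + scaleC +
  fixes cinner :: "'a \<Rightarrow> 'a \<Rightarrow> complex"
  assumes scaleR_scaleC: "r *\<^sub>R x = complex_of_real r *\<^sub>C x"
    and scaleC_add_right: "a *\<^sub>C (x + y) = a *\<^sub>C x + a *\<^sub>C y"
    and scaleC_add_left: "(a + b) *\<^sub>C x = a *\<^sub>C x + b *\<^sub>C x"
    and scaleC_scaleC: "a *\<^sub>C b *\<^sub>C x = (a * b) *\<^sub>C x"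
    and scaleC_one: "1 *\<^sub>C x = x"
    and cinner_commute: "cinner x y = cnj (cinner y x)"
    and cinner_add_right: "cinner x (y + z) = cinner x y + cinner x z"
    and cinner_scaleC_right: "cinner x (a *\<^sub>C y) = a * cinner x y"
    and cinner_self: "cinner x x = complex_of_real ((norm x)\<^sup>2)"

global_interpretation complex_vector:
  vector_space "scaleC :: complex \<Rightarrow> 'a \<Rightarrow> 'a::complex_hilbert_space"
  by unfold_locales
    (simp_all add: scaleC_add_right scaleC_add_left scaleC_scaleC scaleC_one)

(* The existence of such a sequence makes the space separable and infinite-dimensional. *)
definition orthonormal_basis :: "(nat \<Rightarrow> 'a::complex_hilbert_space) \<Rightarrow> bool" where
  "orthonormal_basis \<psi> \<longleftrightarrow>
     (\<forall>m n. cinner (\<psi> m) (\<psi> n) = (if m = n then 1 else 0)) \<and>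
     closure (complex_vector.span (range \<psi>)) = UNIV"

definition hypergeometric_2F3 :: "real \<Rightarrow> real \<Rightarrow> real \<Rightarrow> real \<Rightarrow> real \<Rightarrow> real \<Rightarrow> real" where
  "hypergeometric_2F3 a\<^sub>1 a\<^sub>2 b\<^sub>1 b\<^sub>2 b\<^sub>3 x =
     (\<Sum>n. pochhammer a\<^sub>1 n * pochhammer a\<^sub>2 n /
           (pochhammer b\<^sub>1 n * pochhammer b\<^sub>2 n * pochhammer b\<^sub>3 n) * (x ^ n / fact n))"

(* The Mellin-Barnes integral along the line s = c + i t, where ds = i dt.  The abscissa c is an
   explicit argument; the integral represents the G-function for every c > max_j (- Re b_j).
   At the poles of Gamma (a + s) the quotient is 0, the value of the entire function 1 / Gamma,
   since Gamma is 0 at its poles and division by 0 gives 0. *)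
definition meijer_G3013 ::
    "real \<Rightarrow> complex \<Rightarrow> complex \<Rightarrow> complex \<Rightarrow> complex \<Rightarrow> real \<Rightarrow> complex" where
  "meijer_G3013 c a b\<^sub>1 b\<^sub>2 b\<^sub>3 r =
     1 / (2 * of_real pi * \<i>) *
     (LINT t|lborel.
        (let s = Complex c t
         in Gamma (b\<^sub>1 + s) * Gamma (b\<^sub>2 + s) * Gamma (b\<^sub>3 + s) / Gamma (a + s)
              * complex_of_real r powr (- s) * \<i>))"

definition coherent_N :: "real \<Rightarrow> real \<Rightarrow> real \<Rightarrow> real" where
  "coherent_N \<gamma> \<sigma> x = hypergeometric_2F3 1 1 (2 * \<gamma>) (\<sigma> + 1) (\<sigma> + 1) x"

(* Here and below, z times its conjugate is the real number (cmod z)^2. *)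
definition coherent_state ::
    "(nat \<Rightarrow> 'a::complex_hilbert_space) \<Rightarrow> real \<Rightarrow> real \<Rightarrow> complex \<Rightarrow> 'a" where
  "coherent_state \<psi> \<gamma> \<sigma> z =
     (coherent_N \<gamma> \<sigma> ((cmod z)\<^sup>2) powr (- 1 / 2)) *\<^sub>R
     (\<Sum>n. (complex_of_real (sqrt (fact n / pochhammer (2 * \<gamma>) n))
              * (cnj z ^ n / complex_of_real (pochhammer (\<sigma> + 1) n))) *\<^sub>C \<psi> n)"

(* (1 / (2 pi)) rho d rho d theta on rho > 0, 0 <= theta < 2 pi, transported to the complex plane
   along z = rho e^(i theta). *)
definition polar_measure :: "complex measure" where
  "polar_measure =
     distr
       (density (lborel :: (real \<times> real) measure)
          (\<lambda>(\<rho>, \<theta>). ennreal (\<rho> / (2 * pi)) * indicator ({0<..} \<times> {0..<2 * pi}) (\<rho>, \<theta>)))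
       borel (\<lambda>(\<rho>, \<theta>). complex_of_real \<rho> * cis \<theta>)"

definition coherent_weight :: "real \<Rightarrow> real \<Rightarrow> real \<Rightarrow> complex \<Rightarrow> complex" where
  "coherent_weight c \<gamma> \<sigma> z =
     complex_of_real (2 / (Gamma (2 * \<gamma>) * (Gamma (\<sigma> + 1))\<^sup>2)
       * hypergeometric_2F3 1 1 (2 * \<gamma>) (\<sigma> + 1) (\<sigma> + 1) ((cmod z)\<^sup>2))
     * meijer_G3013 c 0 (of_real (2 * \<gamma> - 1)) (of_real \<sigma>) (of_real \<sigma>) ((cmod z)\<^sup>2)"

(* Re and ennreal do not alter the weight where it is a nonnegative real number. *)
definition coherent_measure :: "real \<Rightarrow> real \<Rightarrow> real \<Rightarrow> complex measure" where
  "coherent_measure c \<gamma> \<sigma> =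
     density polar_measure (\<lambda>z. ennreal (Re (coherent_weight c \<gamma> \<sigma> z)))"

(* The integral of |v z><v z| with respect to M is the identity operator, in the weak sense. *)
definition resolution_of_identity ::
    "complex measure \<Rightarrow> (complex \<Rightarrow> 'a::complex_hilbert_space) \<Rightarrow> bool" where
  "resolution_of_identity M v \<longleftrightarrow>
     (\<forall>f g. integrable M (\<lambda>z. cinner f (v z) * cinner (v z) g) \<and>
            (LINT z|M. cinner f (v z) * cinner (v z) g) = cinner f g)"

end

(* By polarization it suffices to show that the integral of |<v z|h>|^2 is ||h||^2.  Integrating over
   the angle first kills the cross terms of the power series <v z|h> (Parseval on the circle), and
   the normalization cancels against the 2F3 factor of the weight; what remains is the Stieltjes
   moment problem int_0^oo G(r) r^n dr = Gamma(2 gamma + n) Gamma(sigma + 1 + n)^2 / Gamma(n + 1),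
   together with Parseval for the orthonormal basis.

   Under the parameter restriction, one of the three Gamma factors is Gamma(s - alpha) with
   0 <= alpha < 1, and Gamma(s - alpha) / Gamma(s) is the Mellin transform of a nonnegative Beta
   density.  Hence G is the multiplicative convolution of two Gamma densities and a Beta density,
   which gives its sign and, by Tonelli, its moments.  That the Mellin-Barnes integral equals this
   convolution follows by Fubini from the case of one Gamma factor, which is Levy's inversion
   theorem for the logarithm of a Gamma distributed variable. *)
theory Submission
  imports Defs "HOL-Probability.Probability"
begin

section \<open>Mellin kernels and multiplicative convolution\<close>

text \<open>Absolute convergence dictates the order in which the factors are treated. On a vertical
  line the quotient Gamma (s - \<alpha>) / Gamma s decays only like |t| to the power -\<alpha>, with
  \<alpha> < 1, so its own inverse Mellin integral does not converge absolutely. It is bounded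
  there, however, being the Mellin transform of a nonnegative weight. A single Gamma factor, by
  contrast, is integrable. The construction therefore starts from one Gamma factor and lets each
  further factor enter as a bounded multiplier, which is what Fubini requires.

  The two parameter regions are the two ways to find \<alpha>: it is -\<sigma> if \<sigma> \<le> 0
  and 1 - 2\<gamma> otherwise. Then \<alpha> < 1 makes the moment of order 0 finite, and the
  condition on c gives \<alpha> < c, the convergence of the Beta integral on the line. For \<alpha>
  = 0 the Beta density degenerates to the unit mass at 1, hence a separate case.

  Once the sign of G is known, the remaining exchanges of sums and integrals are made in extended
  nonnegative numbers, where measurability suffices; integrability is read off at the end from the
  finite value.\<close>

definition mpow :: "real \<Rightarrow> complex \<Rightarrow> complex" where
  "mpow u s = (if u > 0 then complex_of_real u powr s else 0)"

text \<open>With the value 0 off the positive axis, Mellin integrals can run over all of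
  \<open>lborel\<close>. The exponential form gives joint measurability in base and exponent and
  reduces the power laws to those of \<open>exp\<close> and \<open>ln\<close>.\<close>

lemma mpow_exp: "mpow u s = (if u > 0 then exp (s * complex_of_real (ln u)) else 0)"
  by (simp add: mpow_def powr_def Ln_of_real)

lemma measurable_mpow [measurable]:
  assumes [measurable]: "f \<in> borel_measurable M" "g \<in> borel_measurable M"
  shows "(\<lambda>x. mpow (f x) (g x)) \<in> borel_measurable M"
  unfolding mpow_exp by measurable

lemma measurable_Complex [measurable]:
  assumes [measurable]: "f \<in> borel_measurable M" "g \<in> borel_measurable M"
  shows "(\<lambda>x. Complex (f x) (g x)) \<in> borel_measurable M"
  unfolding Complex_eq by measurable

lemma norm_mpow: "norm (mpow u s) = (if u > 0 then u powr Re s else 0)"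
  by (simp add: mpow_def norm_powr_real_powr)

lemma mpow_mult: "u > 0 \<Longrightarrow> v > 0 \<Longrightarrow> mpow (u * v) s = mpow u s * mpow v s"
  by (simp add: mpow_exp ln_mult distrib_left exp_add)

lemma mpow_add: "mpow u (s + t) = mpow u s * mpow u t"
  by (simp add: mpow_exp distrib_right exp_add)

lemma mpow_divide: "u > 0 \<Longrightarrow> v > 0 \<Longrightarrow> mpow (u / v) (- s) = mpow u (- s) * mpow v s"
  by (simp add: mpow_exp ln_div exp_add[symmetric] algebra_simps)

lemma mpow_of_real: "u > 0 \<Longrightarrow> mpow u (of_real a) = of_real (u powr a)"
  by (simp add: mpow_def powr_of_real)

lemma mpow_of_nat: "u > 0 \<Longrightarrow> mpow u (of_nat n) = of_real (u ^ n)"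
  using mpow_of_real[of u "real n"] by (simp add: powr_realpow)

text \<open>Fubini together with r^(-s) u^s = (r / u)^(-s). The conventions for the two transforms
  differ: \<open>w\<close> is integrated against u^s du, whereas \<open>g\<close> is recovered from
  \<open>F\<close> as in the transform with x^(s - 1) dx. This is why no factor 1 / u appears in the
  convolution.\<close>

lemma mellin_inversion_mult:
  fixes F B :: "real \<Rightarrow> complex" and g w :: "real \<Rightarrow> real" and c :: real
  assumes [measurable]: "w \<in> borel_measurable borel"
    and w: "\<And>u. w u \<ge> 0" "\<And>u. u \<le> 0 \<Longrightarrow> w u = 0"
    and F: "integrable lborel F"
    and inv: "\<And>r. r > 0 \<Longrightarrow>
      (LINT t|lborel. F t * mpow r (- Complex c t)) = complex_of_real (2 * pi * g r)"
    and B: "\<And>t. has_bochner_integral lborel (\<lambda>u. complex_of_real (w u) * mpow u (Complex c t)) (B t)"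
  shows "integrable lborel (\<lambda>t. F t * B t)"
    and "r > 0 \<Longrightarrow> integrable lborel (\<lambda>u. w u * g (r / u))"
    and "r > 0 \<Longrightarrow> (LINT t|lborel. F t * B t * mpow r (- Complex c t))
           = complex_of_real (2 * pi * (LINT u|lborel. w u * g (r / u)))"
proof -
  have [measurable]: "F \<in> borel_measurable borel"
    using F by simp
  define K where "K = (LINT u|lborel. w u * u powr c)"
  have nrm: "norm (complex_of_real (w u) * mpow u (Complex c t)) = w u * u powr c" for u t
    using w[of u] by (cases "u > 0") (auto simp: norm_mult norm_mpow)
  have Bint: "integrable lborel (\<lambda>u. complex_of_real (w u) * mpow u (Complex c t))" 
    and Beq: "B t = (LINT u|lborel. complex_of_real (w u) * mpow u (Complex c t))" for t
    using B[of t] by (auto simp: has_bochner_integral_iff)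
  have Bm [measurable]: "B \<in> borel_measurable borel"
  proof -
    have "(\<lambda>t. LINT u|lborel. complex_of_real (w u) * mpow u (Complex c t)) \<in> borel_measurable borel"
      by measurable
    then show ?thesis using Beq by presburger
  qed
  \<comment> \<open>The modulus of u^(c + it) does not depend on t, so \<open>B\<close> is bounded
    on the whole line by its absolute integral.\<close>
  have Bbd: "norm (B t) \<le> K" for t
    unfolding Beq K_def by (rule order_trans[OF integral_norm_bound]) (simp only: nrm order_refl)
  show FB: "integrable lborel (\<lambda>t. F t * B t)"
  proof (rule Bochner_Integration.integrable_bound[of _ "\<lambda>t. K * norm (F t)"])
    show "AE t in lborel. norm (F t * B t) \<le> norm (K * norm (F t))"
    proof (rule AE_I2)
      fix t
      have "norm (F t * B t) \<le> K * norm (F t)"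
        using Bbd[of t] unfolding norm_mult by (subst mult.commute) (intro mult_right_mono, auto)
      then show "norm (F t * B t) \<le> norm (K * norm (F t))"
        by simp
    qed
  qed (use F in auto)
  fix r :: real assume r: "r > 0"
  define H where "H = (\<lambda>(t, u). F t * mpow r (- Complex c t) * (complex_of_real (w u) * mpow u (Complex c t)))"
  have Hm [measurable]: "H \<in> borel_measurable (lborel \<Otimes>\<^sub>M lborel)"
    unfolding H_def by measurable
  have Hn: "norm (H (t, u)) = norm (F t) * r powr (-c) * (w u * u powr c)" for t u
    unfolding H_def using r by (simp only: prod.case norm_mult[of "F t * _"] nrm) (simp add: norm_mult norm_mpow)
  have Hint: "integrable (lborel \<Otimes>\<^sub>M lborel) H"
  proof (rule lborel_pair.Fubini_integrable)
    show "integrable lborel (\<lambda>t. LINT u|lborel. norm (H (t, u)))"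
      unfolding Hn using F by simp
    show "AE t in lborel. integrable lborel (\<lambda>u. H (t, u))"
      unfolding H_def using Bint by auto
  qed (rule Hm)
  \<comment> \<open>For fixed u the integral over t is the inversion formula for \<open>g\<close> at
    the point r / u.\<close>
  have inner: "(LINT t|lborel. H (t, u)) = complex_of_real (2 * pi * (w u * g (r / u)))" for u
  proof (cases "u > 0")
    case True
    then have "(LINT t|lborel. H (t, u)) = (LINT t|lborel. complex_of_real (w u) * (F t * mpow (r / u) (- Complex c t)))"
      using r by (simp add: H_def mpow_divide mult_ac)
    also have "\<dots> = complex_of_real (w u) * complex_of_real (2 * pi * g (r / u))"
      using inv[of "r / u"] True r by simp
    finally show ?thesis by simp
  qed (simp add: H_def w)
  have "integrable lborel (\<lambda>u. LINT t|lborel. H (t, u))"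
    using lborel_pair.integrable_snd[of "\<lambda>t u. H (t, u)"] Hint by simp
  then have "integrable lborel (\<lambda>u. complex_of_real (2 * pi * (w u * g (r / u))))"
    unfolding inner .
  then have "integrable lborel (\<lambda>u. 2 * pi * (w u * g (r / u)))"
    using complex_of_real_integrable_eq by blast
  then show "integrable lborel (\<lambda>u. w u * g (r / u))"
    by simp
  have "(LINT t|lborel. F t * B t * mpow r (- Complex c t)) = (LINT t|lborel. LINT u|lborel. H (t, u))"
  proof (rule Bochner_Integration.integral_cong)
    fix t
    have "(LINT u|lborel. H (t, u)) = F t * mpow r (- Complex c t) * B t"
      unfolding H_def prod.case Beq by (rule integral_mult_right_zero)
    then show "F t * B t * mpow r (- Complex c t) = (LINT u|lborel. H (t, u))"
      by (simp only: mult_ac)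
  qed simp
  also have "\<dots> = (LINT u|lborel. LINT t|lborel. H (t, u))"
    using lborel_pair.Fubini_integral[of "\<lambda>t u. H (t, u)"] Hint by simp
  also have "\<dots> = complex_of_real (2 * pi * (LINT u|lborel. w u * g (r / u)))"
    unfolding inner by (simp only: integral_complex_of_real integral_mult_right_zero)
  finally show "(LINT t|lborel. F t * B t * mpow r (- Complex c t))
           = complex_of_real (2 * pi * (LINT u|lborel. w u * g (r / u)))" .
qed

text \<open>Tonelli and the substitution r = u x. Its Jacobian u raises the power of u to n + 1: the
  moment of order n is the Mellin transform at s = n + 1. The hypothesis \<open>int\<close> turns
  the Bochner integral into a nonnegative integral; a divergent one would have the default value
  0.\<close>

lemma nn_moment_mult:
  fixes g w :: "real \<Rightarrow> real"
  assumes [measurable]: "w \<in> borel_measurable borel" "g \<in> borel_measurable borel"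
    and w: "\<And>u. w u \<ge> 0" "\<And>u. u \<le> 0 \<Longrightarrow> w u = 0"
    and g: "\<And>u. g u \<ge> 0" "\<And>u. u \<le> 0 \<Longrightarrow> g u = 0"
    and int: "\<And>r. r > 0 \<Longrightarrow> integrable lborel (\<lambda>u. w u * g (r / u))"
  shows "(\<integral>\<^sup>+r. ennreal ((LINT u|lborel. w u * g (r / u)) * r ^ n) \<partial>lborel)
    = (\<integral>\<^sup>+u. ennreal (w u * u ^ Suc n) \<partial>lborel) * (\<integral>\<^sup>+x. ennreal (g x * x ^ n) \<partial>lborel)"
proof -
  have "ennreal ((LINT u|lborel. w u * g (r / u)) * r ^ n)
      = (\<integral>\<^sup>+u. ennreal (w u * g (r / u) * r ^ n) \<partial>lborel)" for r
  proof (cases "r > 0")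
    case True
    have "ennreal (LINT u|lborel. w u * g (r / u) * r ^ n) = (\<integral>\<^sup>+u. ennreal (w u * g (r / u) * r ^ n) \<partial>lborel)"
      by (subst nn_integral_eq_integral) (use int[OF True] w g True in auto)
    then show ?thesis by simp
  next
    case False
    then have z: "w u * g (r / u) = 0" for u
      using w[of u] g(2)[of "r / u"] by (cases "u > 0") (auto simp: divide_nonpos_pos)
    show ?thesis unfolding z by simp
  qed
  then have "(\<integral>\<^sup>+r. ennreal ((LINT u|lborel. w u * g (r / u)) * r ^ n) \<partial>lborel)
      = (\<integral>\<^sup>+r. \<integral>\<^sup>+u. ennreal (w u * g (r / u) * r ^ n) \<partial>lborel \<partial>lborel)"
    by simp
  also have "\<dots> = (\<integral>\<^sup>+u. \<integral>\<^sup>+r. ennreal (w u * g (r / u) * r ^ n) \<partial>lborel \<partial>lborel)"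
    by (rule lborel_pair.Fubini') measurable
  also have "\<dots> = (\<integral>\<^sup>+u. ennreal (w u * u ^ Suc n) * (\<integral>\<^sup>+x. ennreal (g x * x ^ n) \<partial>lborel) \<partial>lborel)"
  proof (rule nn_integral_cong)
    fix u :: real
    show "(\<integral>\<^sup>+r. ennreal (w u * g (r / u) * r ^ n) \<partial>lborel)
      = ennreal (w u * u ^ Suc n) * (\<integral>\<^sup>+x. ennreal (g x * x ^ n) \<partial>lborel)"
    proof (cases "u > 0")
      case True
      have "(\<integral>\<^sup>+r. ennreal (w u * g (r / u) * r ^ n) \<partial>lborel)
          = ennreal u * (\<integral>\<^sup>+x. ennreal (w u * g x * (u * x) ^ n) \<partial>lborel)"
        by (subst nn_integral_real_affine[where c = u and t = 0]) (use True in auto)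
      also have "\<dots> = ennreal u * (\<integral>\<^sup>+x. ennreal (w u * u ^ n) * ennreal (g x * x ^ n) \<partial>lborel)"
      proof -
        have "ennreal (w u * g x * (u * x) ^ n) = ennreal (w u * u ^ n) * ennreal (g x * x ^ n)" for x
          using True w(1)[of u]
          by (cases "x \<ge> 0") (auto simp: ennreal_mult[symmetric] power_mult_distrib g mult_ac)
        then show ?thesis by simp
      qed
      also have "\<dots> = ennreal u * (ennreal (w u * u ^ n) * (\<integral>\<^sup>+x. ennreal (g x * x ^ n) \<partial>lborel))"
        by (subst nn_integral_cmult) auto
      also have "ennreal u * (ennreal (w u * u ^ n) * (\<integral>\<^sup>+x. ennreal (g x * x ^ n) \<partial>lborel))
          = ennreal (w u * u ^ Suc n) * (\<integral>\<^sup>+x. ennreal (g x * x ^ n) \<partial>lborel)"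
        using True w(1)[of u] by (simp add: ennreal_mult mult_ac)
      finally show ?thesis .
    qed (simp add: w)
  qed
  also have "\<dots> = (\<integral>\<^sup>+u. ennreal (w u * u ^ Suc n) \<partial>lborel) * (\<integral>\<^sup>+x. ennreal (g x * x ^ n) \<partial>lborel)"
    by (rule nn_integral_multc) auto
  finally show ?thesis .
qed

section \<open>Gamma and Beta densities\<close>

definition gamma_weight :: "real \<Rightarrow> real \<Rightarrow> real" where
  "gamma_weight q u = (if u > 0 then u powr (q - 1) * exp (- u) else 0)"

text \<open>Against u^s this is Euler's integral for B(s - \<alpha>, \<alpha>), divided by Gamma
  \<alpha>. For \<alpha> > 0 the weight is not integrable at 0 by itself; its transform exists only
  for Re s > \<alpha>.\<close>

definition beta_weight :: "real \<Rightarrow> real \<Rightarrow> real" where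
  "beta_weight \<alpha> u =
     (if 0 < u \<and> u < 1 then u powr (- \<alpha> - 1) * (1 - u) powr (\<alpha> - 1) / Gamma \<alpha> else 0)"

lemma gamma_weight_measurable [measurable]: "gamma_weight q \<in> borel_measurable borel"
  unfolding gamma_weight_def by measurable

lemma gamma_weight_nonneg: "gamma_weight q u \<ge> 0"
  by (simp add: gamma_weight_def)

lemma gamma_weight_nonpos: "u \<le> 0 \<Longrightarrow> gamma_weight q u = 0"
  by (simp add: gamma_weight_def)

lemma beta_weight_measurable [measurable]: "beta_weight \<alpha> \<in> borel_measurable borel"
  unfolding beta_weight_def by measurable

lemma beta_weight_nonneg: "\<alpha> > 0 \<Longrightarrow> beta_weight \<alpha> u \<ge> 0"
  by (simp add: beta_weight_def less_imp_le[OF Gamma_real_pos])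

lemma beta_weight_nonpos: "u \<le> 0 \<Longrightarrow> beta_weight \<alpha> u = 0"
  by (simp add: beta_weight_def)

lemma has_bochner_integral_gamma_weight:
  assumes "q + Re s > 0"
  shows "has_bochner_integral lborel (\<lambda>u. complex_of_real (gamma_weight q u) * mpow u s)
           (Gamma (of_real q + s))"
proof -
  let ?f = "\<lambda>t. complex_of_real t powr (of_real q + s - 1) / of_real (exp t)"
  have "complex_of_real (gamma_weight q u) * mpow u s = indicator {0<..} u *\<^sub>R ?f u" for u
  proof (cases "u > 0")
    case True
    have "complex_of_real u powr (of_real q + s - 1) = mpow u (of_real (q - 1) + s)"
      using True by (simp add: mpow_def algebra_simps)
    also have "\<dots> = of_real (u powr (q - 1)) * mpow u s"
      using True by (simp only: mpow_add mpow_of_real)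
    finally show ?thesis using True
      by (simp add: gamma_weight_def exp_minus field_simps)
  qed (simp add: gamma_weight_def)
  then have eq: "(\<lambda>u. indicator {0<..} u *\<^sub>R ?f u) = (\<lambda>u. complex_of_real (gamma_weight q u) * mpow u s)"
    by simp
  \<comment> \<open>Euler's integral is taken for \<open>lebesgue\<close>; for a Borel integrand,
    integrability and value are the same for \<open>lborel\<close>.\<close>
  have abs: "set_integrable lebesgue {0<..} ?f"
    using absolutely_integrable_Gamma_integral'[of "of_real q + s"] assms by simp
  have "(LINT u:{0<..}|lebesgue. ?f u) = Gamma (of_real q + s)"
    using set_lebesgue_integral_eq_integral(2)[OF abs] Gamma_integral_complex'[of "of_real q + s"] assms
    by (simp add: integral_unique)
  with abs show ?thesis
    unfolding set_integrable_def set_lebesgue_integral_def eq has_bochner_integral_iff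
    by (simp add: integrable_completion integral_completion)
qed

lemma norm_gamma_weight_mpow:
  "norm (complex_of_real (gamma_weight q u) * mpow u s) = gamma_weight q u * u powr Re s"
  by (simp add: norm_mult norm_mpow gamma_weight_def)

lemma gamma_weight_mpow_of_real:
  "complex_of_real (gamma_weight q u) * mpow u (of_real a) = of_real (gamma_weight q u * u powr a)"
  by (cases "u > 0") (simp_all add: mpow_of_real gamma_weight_def)

lemma has_bochner_integral_gamma_weight_real:
  assumes "q + a > 0"
  shows "has_bochner_integral lborel (\<lambda>u. gamma_weight q u * u powr a) (Gamma (q + a))"
proof -
  have "has_bochner_integral lborel (\<lambda>u. complex_of_real (gamma_weight q u * u powr a)) (Gamma (of_real (q + a)))"
    using has_bochner_integral_gamma_weight[of q "of_real a"] assms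
    unfolding gamma_weight_mpow_of_real by simp
  then have "has_bochner_integral lborel (\<lambda>u. complex_of_real (gamma_weight q u * u powr a)) (of_real (Gamma (q + a)))"
    by (simp only: Gamma_complex_of_real)
  then show ?thesis
    by (simp only: has_bochner_integral_iff complex_of_real_integrable_eq integral_complex_of_real of_real_eq_iff)
qed

text \<open>Triangle inequality in Euler's integral, where |u^z| = u^(Re z). It bounds Gamma
  uniformly on a vertical line.\<close>

lemma norm_Gamma_le:
  assumes "Re z > 0"
  shows "norm (Gamma z) \<le> Gamma (Re z)"
proof -
  have "Gamma z = (LINT u|lborel. complex_of_real (gamma_weight 0 u) * mpow u z)"
    using has_bochner_integral_gamma_weight[of 0 z] assms by (simp add: has_bochner_integral_iff)
  also have "norm \<dots> \<le> (LINT u|lborel. norm (complex_of_real (gamma_weight 0 u) * mpow u z))"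
    by (rule integral_norm_bound)
  also have "\<dots> = Gamma (Re z)"
    unfolding norm_gamma_weight_mpow
    using has_bochner_integral_gamma_weight_real[of 0 "Re z"] assms
    by (simp add: has_bochner_integral_integral_eq)
  finally show ?thesis .
qed

section \<open>Gamma on vertical lines\<close>

lemma Gamma_vertical_measurable:
  assumes "c > 0"
  shows "(\<lambda>t. Gamma (Complex c t)) \<in> borel_measurable borel"
proof -
  have "continuous_on UNIV (\<lambda>t. Gamma (Complex c t))"
  proof (rule continuous_on_compose2[of "{z. Re z > 0}" Gamma])
    have "{z. Re z > 0} \<inter> \<int>\<^sub>\<le>\<^sub>0 = {}"
      by (auto elim!: nonpos_Ints_cases)
    then show "continuous_on {z. Re z > 0} Gamma"
      by (rule continuous_on_Gamma)
    show "continuous_on UNIV (Complex c)"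
      unfolding Complex_eq by (intro continuous_intros)
  qed (use assms in auto)
  then show ?thesis by (rule borel_measurable_continuous_onI)
qed

text \<open>Two steps of the functional equation, Gamma s = Gamma (s + 2) / (s (s + 1)), with the
  numerator bounded by Gamma (c + 2), give decay of order 1 / t^2. This crude bound replaces
  Stirling's formula.\<close>

lemma integrable_Gamma_vertical:
  assumes "c > 0"
  shows "integrable lborel (\<lambda>t. Gamma (Complex c t))"
proof -
  \<comment> \<open>Chosen so that m (1 + t^2) \<le> c^2 + t^2 = |s|^2 \<le> |s| |s + 1|.\<close>
  define m where "m = min 1 (c\<^sup>2)"
  have m: "m > 0" "m \<le> 1" "m \<le> c\<^sup>2" using assms by (auto simp: m_def)
  have bd: "norm (Gamma (Complex c t)) \<le> Gamma (c + 2) / m * inverse (1 + t\<^sup>2)" for t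
  proof -
    let ?s = "Complex c t"
    have nz: "?s \<notin> \<int>\<^sub>\<le>\<^sub>0" "?s + 1 \<notin> \<int>\<^sub>\<le>\<^sub>0"
      using assms by (auto elim!: nonpos_Ints_cases simp: complex_eq_iff)
    have "Gamma (?s + 1 + 1) = (?s + 1) * (?s * Gamma ?s)"
      using Gamma_plus1[OF nz(2)] Gamma_plus1[OF nz(1)] by simp
    then have "norm (?s + 1) * norm ?s * norm (Gamma ?s) = norm (Gamma (?s + 1 + 1))"
      by (simp add: norm_mult)
    also have "\<dots> \<le> Gamma (c + 2)"
      using norm_Gamma_le[of "?s + 1 + 1"] assms by (simp add: add.commute add.left_commute)
    finally have 1: "norm (?s + 1) * norm ?s * norm (Gamma ?s) \<le> Gamma (c + 2)" .
    have "norm ?s \<le> norm (?s + 1)"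
      using assms by (simp add: cmod_def power2_eq_square algebra_simps)
    then have "norm ?s * norm ?s \<le> norm (?s + 1) * norm ?s"
      by (intro mult_right_mono) auto
    moreover have "norm ?s * norm ?s = c\<^sup>2 + t\<^sup>2"
      by (simp add: cmod_def)
    moreover have "m * (1 + t\<^sup>2) \<le> c\<^sup>2 + t\<^sup>2"
      using m mult_right_mono[of m 1 "t\<^sup>2"] by (simp add: algebra_simps)
    ultimately have "m * (1 + t\<^sup>2) \<le> norm (?s + 1) * norm ?s"
      by linarith
    then have "m * (1 + t\<^sup>2) * norm (Gamma ?s) \<le> norm (?s + 1) * norm ?s * norm (Gamma ?s)"
      by (intro mult_right_mono) auto
    then have "m * (1 + t\<^sup>2) * norm (Gamma ?s) \<le> Gamma (c + 2)"
      using 1 by linarith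
    moreover have "m * (1 + t\<^sup>2) > 0" using m by (simp add: add_pos_nonneg)
    ultimately have "norm (Gamma ?s) \<le> Gamma (c + 2) / (m * (1 + t\<^sup>2))"
      by (simp only: pos_le_divide_eq mult.commute)
    then show ?thesis
      by (simp add: divide_inverse mult.assoc)
  qed
  have "integrable lborel (\<lambda>t::real. inverse (1 + t\<^sup>2))"
    using integrable_inverse_1_plus_square by (simp add: set_integrable_def einterval_def)
  then have "integrable lborel (\<lambda>t. Gamma (c + 2) / m * inverse (1 + t\<^sup>2))"
    by simp
  then show ?thesis
  proof (rule Bochner_Integration.integrable_bound)
    show "AE t in lborel. norm (Gamma (Complex c t)) \<le> norm (Gamma (c + 2) / m * inverse (1 + t\<^sup>2))"
      using order_trans[OF bd abs_ge_self] by (intro AE_I2) (simp only: real_norm_def)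
  qed (use Gamma_vertical_measurable[OF assms] in simp)
qed

section \<open>Inversion of integrable characteristic functions\<close>

lemma (in real_distribution) measure_Ioc_char_integral:
  assumes "a \<le> b" "measure M {a} = 0" "measure M {b} = 0" and int: "integrable lborel (char M)"
  shows "complex_of_real (measure M {a<..b}) = 1 / (2 * pi) *
     (LINT t|lborel. (iexp (- (t * a)) - iexp (- (t * b))) / (\<i> * t) * char M t)"
proof -
  let ?f = "\<lambda>t. (iexp (- (t * a)) - iexp (- (t * b))) / (\<i> * t) * char M t"
  have [measurable]: "char M \<in> borel_measurable borel" using int by simp
  \<comment> \<open>At t = 0 the quotient is 0 by the convention for division by 0, so the bound
    holds there too.\<close>
  have bd: "norm (?f t) \<le> (b - a) * norm (char M t)" for t
  proof (cases "t = 0")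
    case False
    have "norm ((iexp (- (t * a)) - iexp (- (t * b))) / (\<i> * t)) \<le> b - a"
      using Levy_Inversion_aux2[of "-b" "-a" t] assms(1) False by simp
    then show ?thesis unfolding norm_mult by (intro mult_right_mono) auto
  qed (use assms(1) in simp)
  \<comment> \<open>Levy's theorem gives a limit of integrals truncated to (-T, T); an integrable
    characteristic function dominates them and turns the limit into one integral.\<close>
  have "(\<lambda>T::nat. LINT t|lborel. indicator {-real T<..<real T} t *\<^sub>R ?f t) \<longlonglongrightarrow> (LINT t|lborel. ?f t)"
  proof (rule integral_dominated_convergence[where w = "\<lambda>t. (b - a) * norm (char M t)"])
    show "AE t in lborel. (\<lambda>T::nat. indicator {-real T<..<real T} t *\<^sub>R ?f t) \<longlonglongrightarrow> ?f t"
    proof (rule AE_I2)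
      fix t :: real
      obtain N :: nat where N: "\<bar>t\<bar> < N" using reals_Archimedean2 by blast
      have "\<forall>\<^sub>F T::nat in sequentially. indicator {-real T<..<real T} t *\<^sub>R ?f t = ?f t"
        using eventually_ge_at_top[of N] 
      proof eventually_elim
        case (elim T)
        then have "\<bar>t\<bar> < real T" using N by linarith
        then have "t \<in> {-real T<..<real T}" by auto
        then show ?case by simp
      qed
      then show "(\<lambda>T::nat. indicator {-real T<..<real T} t *\<^sub>R ?f t) \<longlonglongrightarrow> ?f t"
        by (rule tendsto_eventually)
    qed
    show "AE t in lborel. norm (indicator {-real T<..<real T} t *\<^sub>R ?f t) \<le> (b - a) * norm (char M t)" for T :: nat
    proof (rule AE_I2)
      fix t
      have "norm (indicator {-real T<..<real T} t *\<^sub>R ?f t) \<le> norm (?f t)"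
        by (auto simp: indicator_def)
      then show "norm (indicator {-real T<..<real T} t *\<^sub>R ?f t) \<le> (b - a) * norm (char M t)"
        using bd order_trans by blast
    qed
  qed (use int in auto)
  moreover have "(LINT t|lborel. indicator {-real T<..<real T} t *\<^sub>R ?f t) = (CLBINT t=-real T..real T. ?f t)" for T :: nat
    by (simp add: interval_lebesgue_integral_def set_lebesgue_integral_def)
  ultimately have "(\<lambda>T::nat. 1 / (2 * pi) * (CLBINT t=-real T..real T. ?f t)) \<longlonglongrightarrow> 1 / (2 * pi) * (LINT t|lborel. ?f t)"
    by (intro tendsto_mult_left) simp
  moreover have "(\<lambda>T::nat. 1 / (2 * pi) * (CLBINT t=-real T..real T. ?f t)) \<longlonglongrightarrow> of_real (measure M {a<..b})"
    using Levy_Inversion[OF assms(1-3)] by (simp only: of_int_minus of_int_of_nat_eq)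
  ultimately show ?thesis
    by (rule LIMSEQ_unique[rotated])
qed

text \<open>The density is the derivative of the distribution function: the formula for intervals is
  divided by their length, and the limit is taken under the integral. A sequence of lengths is what
  dominated convergence asks for.\<close>

lemma (in real_distribution) char_inversion:
  fixes h :: "nat \<Rightarrow> real"
  assumes null: "\<And>x. measure M {x} = 0" and int: "integrable lborel (char M)"
    and h: "\<And>n. h n > 0" "h \<longlonglongrightarrow> 0"
  shows "(\<lambda>n. complex_of_real (measure M {b<..b + h n} / h n)) \<longlonglongrightarrow>
     1 / (2 * pi) * (LINT t|lborel. iexp (- (t * b)) * char M t)"
proof -
  let ?q = "\<lambda>n t. (iexp (- (t * b)) - iexp (- (t * (b + h n)))) / (\<i> * t) / h n"
  have [measurable]: "char M \<in> borel_measurable borel" using int by simp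
  have "(\<lambda>n. LINT t|lborel. ?q n t * char M t) \<longlonglongrightarrow> (LINT t|lborel. iexp (- (t * b)) * char M t)"
  proof (rule integral_dominated_convergence[where w = "\<lambda>t. norm (char M t)"])
    \<comment> \<open>\<open>?q n t\<close> is the difference quotient of z \<mapsto> exp (-\<i> t
      z) at b, divided by -\<i> t.\<close>
    have "(\<lambda>n. ?q n t * char M t) \<longlonglongrightarrow> iexp (- (t * b)) * char M t" if "t \<noteq> 0" for t
    proof -
      let ?e = "\<lambda>z. exp (- (\<i> * complex_of_real t * z))"
      have "(?e has_field_derivative - (\<i> * t) * ?e b) (at (complex_of_real b))"
        by (auto intro!: derivative_eq_intros)
      then have "(\<lambda>z. (?e (complex_of_real b + z) - ?e b) / z) \<midarrow>0\<rightarrow> - (\<i> * t) * ?e b"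
        by (simp add: DERIV_def)
      moreover have "filterlim (\<lambda>n. complex_of_real (h n)) (at 0) sequentially"
        using h tendsto_of_real[OF h(2), where ?'a = complex]
        by (auto simp: filterlim_at less_imp_neq[THEN not_sym] intro!: always_eventually)
      ultimately have "(\<lambda>n. (?e (complex_of_real b + h n) - ?e b) / h n) \<longlonglongrightarrow> - (\<i> * t) * ?e b"
        by (rule filterlim_compose)
      then have "(\<lambda>n. (?e (complex_of_real b + h n) - ?e b) / h n / (- (\<i> * t)) * char M t)
          \<longlonglongrightarrow> - (\<i> * t) * ?e b / (- (\<i> * t)) * char M t"
        using that by (intro tendsto_intros) auto
      moreover have "(?e (complex_of_real b + h n) - ?e b) / h n / (- (\<i> * t)) * char M t = ?q n t * char M t" for n
        using that h(1)[of n] by (simp add: field_simps)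
      moreover have "- (\<i> * t) * ?e b / (- (\<i> * t)) * char M t = iexp (- (t * b)) * char M t"
        using that by (simp add: field_simps)
      ultimately show ?thesis by (simp only:)
    qed
    \<comment> \<open>The point t = 0 has to be left out: there \<open>?q\<close> is 0 by division
      by 0, while the limit would be 1.\<close>
    then show "AE t in lborel. (\<lambda>n. ?q n t * char M t) \<longlonglongrightarrow> iexp (- (t * b)) * char M t"
      using AE_lborel_singleton[of 0] by (auto elim: eventually_mono)
    show "AE t in lborel. norm (?q n t * char M t) \<le> norm (char M t)" for n
    proof (rule AE_I2)
      fix t :: real
      have "norm (?q n t) \<le> 1"
      proof (cases "t = 0")
        case False
        have "norm ((iexp (- (t * b)) - iexp (- (t * (b + h n)))) / (\<i> * t)) \<le> h n"
          using Levy_Inversion_aux2[of "-(b + h n)" "-b" t] h(1)[of n] False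
          by (simp only: mult_minus_right) simp
        then show ?thesis using h(1)[of n] unfolding norm_divide[of _ "complex_of_real (h n)"]
          by (simp add: divide_le_eq)
      qed simp
      then show "norm (?q n t * char M t) \<le> norm (char M t)"
        unfolding norm_mult by (simp add: mult_left_le_one_le)
    qed
  qed (use int in auto)
  then have "(\<lambda>n. 1 / (2 * pi) * (LINT t|lborel. ?q n t * char M t)) \<longlonglongrightarrow>
      1 / (2 * pi) * (LINT t|lborel. iexp (- (t * b)) * char M t)"
    by (rule tendsto_mult_left)
  moreover have "1 / (2 * pi) * (LINT t|lborel. ?q n t * char M t) = complex_of_real (measure M {b<..b + h n} / h n)" for n
  proof -
    have "(LINT t|lborel. ?q n t * char M t) =
      (LINT t|lborel. (iexp (- (t * b)) - iexp (- (t * (b + h n)))) / (\<i> * t) * char M t / h n)"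
      by (intro Bochner_Integration.integral_cong) auto
    also have "\<dots> = (LINT t|lborel. (iexp (- (t * b)) - iexp (- (t * (b + h n)))) / (\<i> * t) * char M t) / h n"
      by (rule integral_divide_zero)
    finally show ?thesis
      using measure_Ioc_char_integral[of b "b + h n"] h(1)[of n] null int by (simp add: less_imp_le)
  qed
  ultimately show ?thesis by simp
qed

text \<open>If U is Gamma distributed with shape c, then ln U has characteristic function Gamma (c +
  it) / Gamma c and density d(x) x at ln x. Inversion equates the two, and x^c / Gamma c cancels to
  leave exp (-x).\<close>

lemma Gamma_inverse_mellin:
  assumes c: "c > 0" and x: "x > 0"
  shows "(LINT t|lborel. Gamma (Complex c t) * mpow x (- Complex c t)) = complex_of_real (2 * pi * exp (- x))"
proof -
  define d where "d = (\<lambda>u. gamma_weight c u / Gamma c)"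
  define N where "N = density lborel (\<lambda>u. ennreal (d u))"
  define M where "M = distr N borel ln"
  define b where "b = ln x"
  have eb: "exp b = x" using x by (simp add: b_def)
  have Gc: "Gamma c > 0" using c by (rule Gamma_real_pos)
  have d_meas [measurable]: "d \<in> borel_measurable borel"
    unfolding d_def by measurable
  have d_nonneg: "d u \<ge> 0" for u
    unfolding d_def using Gc gamma_weight_nonneg[of c u] by simp
  have d_pos: "u > 0 \<Longrightarrow> d u = u powr (c - 1) * exp (- u) / Gamma c" for u
    by (simp add: d_def gamma_weight_def)
  have setsN [measurable_cong]: "sets N = sets borel" by (simp add: N_def)
  have int_M: "integral\<^sup>L M f = (LINT u|lborel. d u *\<^sub>R f (ln u))" if [measurable]: "f \<in> borel_measurable borel"
    for f :: "real \<Rightarrow> 'b::{banach, second_countable_topology}"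
    unfolding M_def N_def by (simp add: integral_distr integral_density d_nonneg)
  have d_int: "has_bochner_integral lborel d 1"
  proof -
    have "has_bochner_integral lborel (\<lambda>u. gamma_weight c u * u powr 0 / Gamma c) (Gamma (c + 0) / Gamma c)"
      using c by (intro has_bochner_integral_divide_zero has_bochner_integral_gamma_weight_real) simp
    moreover have "gamma_weight c u * u powr 0 / Gamma c = d u" for u
      by (simp add: d_def gamma_weight_def)
    ultimately show ?thesis using Gc by simp
  qed
  have "emeasure N (space N) = 1"
    using d_int d_nonneg unfolding N_def has_bochner_integral_iff
    by (simp add: emeasure_density nn_integral_eq_integral)
  then have "prob_space N" by (rule prob_spaceI)
  then have "prob_space M"
    unfolding M_def by (intro prob_space.prob_space_distr) measurable
  then interpret real_distribution M
    by (intro real_distribution.intro real_distribution_axioms.intro) (simp_all add: M_def)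
  have char: "char M t = Gamma (Complex c t) / Gamma c" for t
  proof -
    have "char M t = (LINT u|lborel. complex_of_real (gamma_weight c u) * mpow u (Complex 0 t) / Gamma c)"
      unfolding char_def
    proof (subst int_M)
      show "(LINT u|lborel. d u *\<^sub>R iexp (t * ln u)) =
        (LINT u|lborel. complex_of_real (gamma_weight c u) * mpow u (Complex 0 t) / Gamma c)"
        by (intro Bochner_Integration.integral_cong)
           (auto simp: d_def gamma_weight_def mpow_exp Complex_eq scaleR_conv_of_real mult_ac)
    qed measurable
    also have "\<dots> = Gamma (of_real c + Complex 0 t) / Gamma c"
      using has_bochner_integral_gamma_weight[of c "Complex 0 t"] c
      by (simp add: has_bochner_integral_iff)
    also have "of_real c + Complex 0 t = Complex c t"
      by (simp add: complex_eq_iff)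
    finally show ?thesis .
  qed
  have char_int: "integrable lborel (char M)"
    unfolding char using integrable_Gamma_vertical[OF c] by simp
  have meas_M: "measure M A = (LINT u|lborel. d u * indicator A (ln u))" if "A \<in> sets borel" for A
    using int_M[of "indicator A :: real \<Rightarrow> real"] that by simp
  have null: "measure M {a} = 0" for a
  proof -
    have "(LINT u|lborel. d u * indicator {a} (ln u)) = (LINT u|(lborel::real measure). 0)"
    proof (rule integral_cong_AE)
      show "AE u in lborel. d u * indicator {a} (ln u) = 0"
        using AE_lborel_singleton[of "exp a"]
      proof eventually_elim
        case (elim u)
        then show ?case
          by (cases "u > 0") (auto simp: d_def gamma_weight_def indicator_def)
      qed
    qed measurable
    then show ?thesis by (simp add: meas_M)
  qed
  have Ioc: "measure M {b<..b'} = integral {x..exp b'} d" if "b \<le> b'" for b'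
  proof -
    have "continuous_on {x..exp b'} (\<lambda>u. u powr (c - 1) * exp (- u) / Gamma c)"
      using x Gc by (intro continuous_intros) auto
    then have "continuous_on {x..exp b'} d"
      using x by (subst continuous_on_cong[OF refl d_pos]) auto
    then have si: "set_integrable lborel {x..exp b'} d"
      by (rule borel_integrable_atLeastAtMost')
    have "measure M {b<..b'} = (LINT u:{x..exp b'}|lborel. d u)"
      unfolding set_lebesgue_integral_def meas_M[of "{b<..b'}", simplified]
    proof (rule integral_cong_AE)
      show "AE u in lborel. d u * indicator {b<..b'} (ln u) = indicator {x..exp b'} u *\<^sub>R d u"
        using AE_lborel_singleton[of x]
      proof eventually_elim
        case (elim u)
        show ?case
        proof (cases "u > 0")
          case True
          then have "ln u \<in> {b<..b'} \<longleftrightarrow> u \<in> {x..exp b'}"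
            using elim x ln_le_cancel_iff[of u "exp b'"] ln_less_cancel_iff[of x u]
            by (auto simp: b_def)
          then show ?thesis by (auto simp: indicator_def)
        qed (simp add: d_def gamma_weight_nonpos)
      qed
    qed measurable
    then show ?thesis
      using set_borel_integral_eq_integral(2)[OF si] by simp
  qed
  define h where "h = (\<lambda>n. 1 / real (Suc n))"
  have h: "h n > 0" "h n \<le> 1" for n
    by (auto simp: h_def)
  have hlim: "h \<longlonglongrightarrow> 0"
    using LIMSEQ_inverse_real_of_nat by (simp add: h_def inverse_eq_divide)
  \<comment> \<open>The density of ln U at b is obtained by the chain rule: \<open>J\<close> is the
    distribution function of U counted from x, and \<open>y n\<close> = exp (b + h n) approaches x
    from the right. A one-sided derivative of \<open>J\<close> at x therefore suffices.\<close>
  define J where "J = (\<lambda>y. integral {x..y} d)"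
  define y where "y = (\<lambda>n. exp (b + h n))"
  have y: "y n > x" "y n \<le> exp (b + 1)" for n
    using h[of n] by (auto simp: y_def simp flip: eb)
  have ylim: "y \<longlonglongrightarrow> x"
    unfolding y_def using hlim by (auto intro!: tendsto_eq_intros simp: eb)
  have "continuous_on {x..exp (b + 1)} (\<lambda>u. u powr (c - 1) * exp (- u) / Gamma c)"
    using x Gc by (intro continuous_intros) auto
  then have "continuous_on {x..exp (b + 1)} d"
    using x by (subst continuous_on_cong[OF refl d_pos]) auto
  then have "(J has_real_derivative d x) (at x within {x..exp (b + 1)})"
    unfolding J_def by (rule integral_has_real_derivative) (simp flip: eb)
  then have "((\<lambda>y. (J y - J x) / (y - x)) \<longlongrightarrow> d x) (at x within {x..exp (b + 1)})"
    by (simp add: has_field_derivative_iff)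
  moreover have "filterlim y (at x within {x..exp (b + 1)}) sequentially"
    using y ylim by (auto simp: filterlim_at less_imp_le less_imp_neq[THEN not_sym] intro!: always_eventually)
  ultimately have 1: "(\<lambda>n. (J (y n) - J x) / (y n - x)) \<longlonglongrightarrow> d x"
    by (rule filterlim_compose)
  have "(\<lambda>h. (exp (b + h) - exp b) / h) \<midarrow>0\<rightarrow> exp b"
    using DERIV_exp[of b] by (simp add: DERIV_def)
  moreover have "filterlim h (at 0) sequentially"
    using h(1) hlim by (auto simp: filterlim_at less_imp_neq[THEN not_sym] intro!: always_eventually)
  ultimately have 2: "(\<lambda>n. (exp (b + h n) - exp b) / h n) \<longlonglongrightarrow> exp b"
    by (rule filterlim_compose)
  have "(\<lambda>n. (J (y n) - J x) / (y n - x) * ((exp (b + h n) - exp b) / h n)) \<longlonglongrightarrow> d x * exp b"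
    by (intro tendsto_mult 1 2)
  moreover have "(J (y n) - J x) / (y n - x) * ((exp (b + h n) - exp b) / h n) = measure M {b<..b + h n} / h n" for n
  proof -
    have "J x = 0" by (simp add: J_def)
    moreover have "measure M {b<..b + h n} = J (y n)"
      using Ioc[of "b + h n"] h[of n] by (simp add: J_def y_def)
    moreover have "exp (b + h n) - exp b = y n - x" by (simp add: y_def eb)
    ultimately show ?thesis using y(1)[of n] by simp
  qed
  ultimately have "(\<lambda>n. measure M {b<..b + h n} / h n) \<longlonglongrightarrow> d x * x"
    by (simp add: eb)
  then have "(\<lambda>n. complex_of_real (measure M {b<..b + h n} / h n)) \<longlonglongrightarrow> complex_of_real (d x * x)"
    by (rule tendsto_of_real)
  then have "1 / (2 * pi) * (LINT t|lborel. iexp (- (t * b)) * char M t) = complex_of_real (d x * x)"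
    using char_inversion[OF null char_int h(1) hlim] LIMSEQ_unique by blast
  then have inv: "(LINT t|lborel. iexp (- (t * b)) * char M t) = complex_of_real (2 * pi * (d x * x))"
    by (simp add: field_simps)
  have "(LINT t|lborel. Gamma (Complex c t) * mpow x (- Complex c t))
      = (LINT t|lborel. of_real (Gamma c * x powr (- c)) * (iexp (- (t * b)) * char M t))"
  proof (intro Bochner_Integration.integral_cong refl)
    fix t
    \<comment> \<open>On the line, x^(-s) is the constant x^(-c) times the oscillation exp (-\<i> t
      ln x) of the Fourier integral.\<close>
    have "mpow x (- Complex c t) = mpow x (of_real (- c)) * mpow x (Complex 0 (- t))"
      unfolding mpow_add[symmetric] by (rule arg_cong[where f = "mpow x"]) (simp add: complex_eq_iff)
    also have "mpow x (of_real (- c)) = of_real (x powr (- c))"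
      by (rule mpow_of_real[OF x])
    also have "mpow x (Complex 0 (- t)) = iexp (- (t * b))"
      using x by (simp add: mpow_exp b_def Complex_eq mult_ac)
    finally show "Gamma (Complex c t) * mpow x (- Complex c t)
        = of_real (Gamma c * x powr (- c)) * (iexp (- (t * b)) * char M t)"
      using Gc by (simp add: char)
  qed
  also have "\<dots> = of_real (Gamma c * x powr (- c)) * (LINT t|lborel. iexp (- (t * b)) * char M t)"
    by (rule integral_mult_right_zero)
  also have "\<dots> = complex_of_real (2 * pi * (Gamma c * x powr (- c) * (d x * x)))"
    unfolding inv by (simp only: of_real_mult mult_ac)
  also have "Gamma c * x powr (- c) * (d x * x) = exp (- x)"
    using x Gc by (simp add: d_pos powr_diff powr_minus field_simps)
  finally show ?thesis .
qed

section \<open>The Beta integral with a complex exponent\<close>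

lemma integrable_beta_weight:
  assumes "\<alpha> > 0" "a > \<alpha>"
  shows "integrable lborel (\<lambda>u. beta_weight \<alpha> u * u powr a)"
proof -
  have "integrable lborel (\<lambda>u::real. indicator {0..1} u *\<^sub>R (u powr (a - \<alpha> - 1) * (1 - u) powr (\<alpha> - 1)) / Gamma \<alpha>)"
    using integrable_Beta[of "a - \<alpha>" \<alpha>] assms unfolding set_integrable_def
    by (intro integrable_divide) auto
  also have "(\<lambda>u::real. indicator {0..1} u *\<^sub>R (u powr (a - \<alpha> - 1) * (1 - u) powr (\<alpha> - 1)) / Gamma \<alpha>)
      = (\<lambda>u. beta_weight \<alpha> u * u powr a)"
  proof
    fix u :: real
    have "u > 0 \<Longrightarrow> u powr (a - \<alpha> - 1) = u powr (- \<alpha> - 1) * u powr a"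
      by (simp add: powr_add[symmetric] algebra_simps)
    then show "indicator {0..1} u *\<^sub>R (u powr (a - \<alpha> - 1) * (1 - u) powr (\<alpha> - 1)) / Gamma \<alpha> = beta_weight \<alpha> u * u powr a"
      by (cases "0 < u \<and> u < 1") (auto simp: beta_weight_def indicator_def)
  qed
  finally show ?thesis .
qed

text \<open>The classical evaluation of Gamma (s - \<alpha>) Gamma \<alpha> as a double integral
  over 0 < x < y. Integrating over y first separates the two Gamma integrals; the substitution x = y
  u splits off the Beta integral and leaves Gamma s.\<close>

lemma has_bochner_integral_beta_weight:
  assumes \<alpha>: "\<alpha> > 0" and s: "Re s > \<alpha>"
  shows "has_bochner_integral lborel (\<lambda>u. complex_of_real (beta_weight \<alpha> u) * mpow u s)
           (Gamma (s - of_real \<alpha>) / Gamma s)"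
proof -
  have G\<alpha>: "Gamma \<alpha> > 0" using \<alpha> by (rule Gamma_real_pos)
  have int: "integrable lborel (\<lambda>u. complex_of_real (beta_weight \<alpha> u) * mpow u s)"
  proof (rule Bochner_Integration.integrable_bound[OF integrable_beta_weight[OF \<alpha> s]])
    show "AE u in lborel. norm (complex_of_real (beta_weight \<alpha> u) * mpow u s) \<le> norm (beta_weight \<alpha> u * u powr Re s)"
      by (intro AE_I2) (auto simp: norm_mult norm_mpow abs_mult)
  qed measurable
  define B where "B = (LINT u|lborel. complex_of_real (beta_weight \<alpha> u) * mpow u s)"
  define f where "f = (\<lambda>x. complex_of_real (gamma_weight (- \<alpha>) x) * mpow x s)"
  define H where "H = (\<lambda>(x, y). f x * complex_of_real (gamma_weight \<alpha> (y - x)))"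
  have [measurable]: "f \<in> borel_measurable borel" unfolding f_def by measurable
  have Hm [measurable]: "H \<in> borel_measurable (lborel \<Otimes>\<^sub>M lborel)"
    unfolding H_def by measurable
  have f: "has_bochner_integral lborel f (Gamma (s - of_real \<alpha>))"
    using has_bochner_integral_gamma_weight[of "- \<alpha>" s] s by (simp add: f_def)
  have g: "has_bochner_integral lborel (\<lambda>y. gamma_weight \<alpha> (y - x)) (Gamma \<alpha>)" for x
  proof -
    have z: "(\<lambda>u. gamma_weight \<alpha> u * u powr 0) = gamma_weight \<alpha>"
      by (auto simp: gamma_weight_def)
    have "has_bochner_integral lborel (gamma_weight \<alpha>) (Gamma \<alpha>)"
      using has_bochner_integral_gamma_weight_real[of \<alpha> 0] \<alpha> unfolding z by simp
    then show ?thesis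
      using lborel_has_bochner_integral_real_affine_iff[of 1 "gamma_weight \<alpha>" "Gamma \<alpha>" "- x"] by simp
  qed
  have Hy: "has_bochner_integral lborel (\<lambda>y. H (x, y)) (f x * complex_of_real (Gamma \<alpha>))" for x
    unfolding H_def prod.case
    by (intro has_bochner_integral_mult_right has_bochner_integral_of_real g)
  have Hn: "norm (H (x, y)) = norm (f x) * gamma_weight \<alpha> (y - x)" for x y
    by (simp add: H_def norm_mult gamma_weight_nonneg)
  have Hn_int: "(LINT y|lborel. norm (H (x, y))) = norm (f x) * Gamma \<alpha>" for x
    unfolding Hn using g[of x] by (simp add: has_bochner_integral_iff)
  have Hint: "integrable (lborel \<Otimes>\<^sub>M lborel) H"
  proof (rule lborel_pair.Fubini_integrable)
    show "integrable lborel (\<lambda>x. LINT y|lborel. norm (H (x, y)))"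
      unfolding Hn_int using f by (simp add: has_bochner_integral_iff)
    show "AE x in lborel. integrable lborel (\<lambda>y. H (x, y))"
      using Hy by (simp add: has_bochner_integral_iff)
  qed (rule Hm)
  have inner: "(LINT x|lborel. H (x, y)) = complex_of_real (gamma_weight 0 y) * mpow y s * (complex_of_real (Gamma \<alpha>) * B)" for y
  proof (cases "y > 0")
    case True
    have "(LINT x|lborel. H (x, y)) = y *\<^sub>R (LINT u|lborel. H (y * u, y))"
      using lborel_integral_real_affine[of y "\<lambda>x. H (x, y)" 0] True by simp
    also have "\<dots> = (LINT u|lborel. y *\<^sub>R H (y * u, y))"
      by simp
    also have "\<dots> = (LINT u|lborel. complex_of_real (gamma_weight 0 y) * mpow y s *
        (complex_of_real (Gamma \<alpha>) * (complex_of_real (beta_weight \<alpha> u) * mpow u s)))"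
    proof (rule integral_cong_AE)
      show "AE u in lborel. y *\<^sub>R H (y * u, y) = complex_of_real (gamma_weight 0 y) * mpow y s *
        (complex_of_real (Gamma \<alpha>) * (complex_of_real (beta_weight \<alpha> u) * mpow u s))"
      proof (rule AE_I2)
        fix u :: real
        consider "u \<le> 0" | "u \<ge> 1" | "0 < u" "u < 1" by linarith
        then show "y *\<^sub>R H (y * u, y) = complex_of_real (gamma_weight 0 y) * mpow y s *
        (complex_of_real (Gamma \<alpha>) * (complex_of_real (beta_weight \<alpha> u) * mpow u s))"
        proof cases
          case 1
          then show ?thesis using True
            by (simp add: H_def f_def gamma_weight_nonpos beta_weight_nonpos mult_nonneg_nonpos)
        next
          case 2
          then show ?thesis using True by (simp add: H_def beta_weight_def gamma_weight_nonpos)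
        next
          case 3
          have e: "y - y * u = y * (1 - u)" by (simp add: algebra_simps)
          have "y * (gamma_weight (- \<alpha>) (y * u) * gamma_weight \<alpha> (y - y * u))
            = y * (y powr (- \<alpha> - 1) * y powr (\<alpha> - 1)) * (exp (- (y * u)) * exp (- (y - y * u))) *
                (u powr (- \<alpha> - 1) * (1 - u) powr (\<alpha> - 1))"
            unfolding e using True 3 by (simp add: gamma_weight_def powr_mult mult_ac)
          \<comment> \<open>The powers of y, including the Jacobian y, collect to y^(-1), which
            together with exp (-y) is \<open>gamma_weight 0 y\<close>.\<close>
          also have "y powr (- \<alpha> - 1) * y powr (\<alpha> - 1) = y powr (- 2)"
            by (simp flip: powr_add)
          also have "y * y powr (- 2) = y powr (-1)"
            using True powr_add[of y 1 "- 2"] by simp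
          also have "exp (- (y * u)) * exp (- (y - y * u)) = exp (- y)"
            by (simp flip: exp_add)
          finally have "y * (gamma_weight (- \<alpha>) (y * u) * gamma_weight \<alpha> (y - y * u))
              = gamma_weight 0 y * (Gamma \<alpha> * beta_weight \<alpha> u)"
            using True 3 G\<alpha> by (simp add: gamma_weight_def beta_weight_def)
          then have "complex_of_real (y * (gamma_weight (- \<alpha>) (y * u) * gamma_weight \<alpha> (y - y * u))) * mpow (y * u) s
              = complex_of_real (gamma_weight 0 y * (Gamma \<alpha> * beta_weight \<alpha> u)) * mpow (y * u) s"
            by simp
          then show ?thesis using True 3
            unfolding H_def f_def prod.case scaleR_conv_of_real
            by (simp only: of_real_mult mpow_mult mult_ac)
        qed
      qed
    qed measurable
    also have "\<dots> = complex_of_real (gamma_weight 0 y) * mpow y s * (complex_of_real (Gamma \<alpha>) * B)"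
      by (simp add: B_def)
    finally show ?thesis .
  next
    case False
    have "H (x, y) = 0" for x
      using False by (cases "x \<le> 0") (auto simp: H_def f_def gamma_weight_nonpos)
    then show ?thesis using False by (simp add: gamma_weight_nonpos)
  qed
  have "(LINT x|lborel. LINT y|lborel. H (x, y)) = Gamma (s - of_real \<alpha>) * of_real (Gamma \<alpha>)"
    using Hy f by (simp add: has_bochner_integral_iff)
  moreover have "(LINT y|lborel. LINT x|lborel. H (x, y)) = Gamma s * (of_real (Gamma \<alpha>) * B)"
    unfolding inner using has_bochner_integral_gamma_weight[of 0 s] s \<alpha>
    by (simp add: has_bochner_integral_iff)
  moreover have "(LINT y|lborel. LINT x|lborel. H (x, y)) = (LINT x|lborel. LINT y|lborel. H (x, y))"
    using lborel_pair.Fubini_integral[of "\<lambda>x y. H (x, y)"] Hint by simp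
  ultimately have "Gamma s * B = Gamma (s - of_real \<alpha>)"
    using G\<alpha> by simp
  moreover have "Gamma s \<noteq> 0"
    using s \<alpha> by (auto simp: Gamma_eq_zero_iff elim!: nonpos_Ints_cases)
  ultimately have "B = Gamma (s - of_real \<alpha>) / Gamma s"
    by (simp add: field_simps)
  with int show ?thesis by (simp add: has_bochner_integral_iff B_def)
qed

section \<open>The product of the Gamma factors as the transform of a density\<close>

lemma Gamma_shift_inverse_mellin:
  assumes "c + p > 0"
  shows "integrable lborel (\<lambda>t. Gamma (of_real p + Complex c t))"
    and "r > 0 \<Longrightarrow> (LINT t|lborel. Gamma (of_real p + Complex c t) * mpow r (- Complex c t))
           = complex_of_real (2 * pi * gamma_weight (p + 1) r)"
proof -
  \<comment> \<open>Shifting the argument by p moves the line to abscissa c + p and multiplies the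
    inverse transform by r^p.\<close>
  have eq: "of_real p + Complex c t = Complex (c + p) t" for t
    by (simp add: complex_eq_iff)
  show "integrable lborel (\<lambda>t. Gamma (of_real p + Complex c t))"
    unfolding eq using integrable_Gamma_vertical assms by simp
  assume r: "r > 0"
  have "mpow r (- Complex c t) = of_real (r powr p) * mpow r (- Complex (c + p) t)" for t
    unfolding mpow_of_real[OF r, symmetric] mpow_add[symmetric]
    by (rule arg_cong[where f = "mpow r"]) (simp add: complex_eq_iff)
  then have "(LINT t|lborel. Gamma (of_real p + Complex c t) * mpow r (- Complex c t))
      = (LINT t|lborel. of_real (r powr p) * (Gamma (Complex (c + p) t) * mpow r (- Complex (c + p) t)))"
    unfolding eq by (simp add: mult_ac)
  also have "\<dots> = of_real (r powr p) * of_real (2 * pi * exp (- r))"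
    using Gamma_inverse_mellin[OF assms r] by simp
  also have "\<dots> = complex_of_real (2 * pi * gamma_weight (p + 1) r)"
    using r by (simp add: gamma_weight_def)
  finally show "(LINT t|lborel. Gamma (of_real p + Complex c t) * mpow r (- Complex c t))
           = complex_of_real (2 * pi * gamma_weight (p + 1) r)" .
qed

lemma nn_integral_gamma_weight_power:
  assumes "q + n > 0"
  shows "(\<integral>\<^sup>+u. ennreal (gamma_weight q u * u ^ n) \<partial>lborel) = ennreal (Gamma (q + n))"
proof -
  have eq: "(\<lambda>u. gamma_weight q u * u powr real n) = (\<lambda>u. gamma_weight q u * u ^ n)"
    by (auto simp: gamma_weight_def powr_realpow)
  have "has_bochner_integral lborel (\<lambda>u. gamma_weight q u * u ^ n) (Gamma (q + n))"
    using has_bochner_integral_gamma_weight_real[of q "real n"] assms unfolding eq by simp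
  moreover have "gamma_weight q u * u ^ n \<ge> 0" for u
    by (simp add: gamma_weight_def)
  ultimately show ?thesis
    by (simp add: nn_integral_eq_integral has_bochner_integral_iff)
qed

lemma nn_integral_beta_weight_power:
  assumes "\<alpha> > 0" "\<alpha> < n"
  shows "(\<integral>\<^sup>+u. ennreal (beta_weight \<alpha> u * u ^ n) \<partial>lborel) = ennreal (Gamma (n - \<alpha>) / Gamma n)"
proof -
  have eq: "(\<lambda>u. complex_of_real (beta_weight \<alpha> u) * mpow u (of_nat n)) = (\<lambda>u. complex_of_real (beta_weight \<alpha> u * u ^ n))"
  proof
    fix u
    show "complex_of_real (beta_weight \<alpha> u) * mpow u (of_nat n) = complex_of_real (beta_weight \<alpha> u * u ^ n)"
      by (cases "u > 0") (simp_all add: mpow_of_nat beta_weight_nonpos)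
  qed
  have val: "Gamma (of_nat n - of_real \<alpha>) / Gamma (of_nat n) = complex_of_real (Gamma (n - \<alpha>) / Gamma n)"
    by (simp flip: Gamma_complex_of_real)
  have "has_bochner_integral lborel (\<lambda>u. complex_of_real (beta_weight \<alpha> u * u ^ n)) (complex_of_real (Gamma (n - \<alpha>) / Gamma n))"
    using has_bochner_integral_beta_weight[of \<alpha> "of_nat n"] assms unfolding eq val by simp
  then have "has_bochner_integral lborel (\<lambda>u. beta_weight \<alpha> u * u ^ n) (Gamma (n - \<alpha>) / Gamma n)"
    by (simp only: has_bochner_integral_iff complex_of_real_integrable_eq integral_complex_of_real of_real_eq_iff)
  moreover have "beta_weight \<alpha> u * u ^ n \<ge> 0" for u
    using beta_weight_nonneg[OF assms(1), of u] by (cases "u > 0") (simp_all add: beta_weight_nonpos)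
  ultimately show ?thesis
    by (simp add: nn_integral_eq_integral has_bochner_integral_iff)
qed

text \<open>For the Haar measure du / u of the positive reals this is the convolution of u w(u) with
  g.\<close>

definition mult_conv :: "(real \<Rightarrow> real) \<Rightarrow> (real \<Rightarrow> real) \<Rightarrow> real \<Rightarrow> real" where
  "mult_conv w g r = (LINT u|lborel. w u * g (r / u))"

lemma measurable_mult_conv:
  assumes [measurable]: "w \<in> borel_measurable borel" "g \<in> borel_measurable borel"
  shows "mult_conv w g \<in> borel_measurable borel"
  unfolding mult_conv_def by measurable

lemma mult_conv_nonneg: "(\<And>u. w u \<ge> 0) \<Longrightarrow> (\<And>u. g u \<ge> 0) \<Longrightarrow> mult_conv w g r \<ge> 0"
  unfolding mult_conv_def by (intro Bochner_Integration.integral_nonneg) simp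

lemma mult_conv_nonpos:
  assumes "\<And>u. u \<le> 0 \<Longrightarrow> w u = 0" "\<And>u. u \<le> 0 \<Longrightarrow> g u = 0" "r \<le> 0"
  shows "mult_conv w g r = 0"
proof -
  have "w u * g (r / u) = 0" for u
    using assms(1)[of u] assms(2)[of "r / u"] assms(3) by (cases "u > 0") (auto simp: divide_nonpos_pos)
  then show ?thesis unfolding mult_conv_def by (simp only: Bochner_Integration.integral_zero)
qed

text \<open>The factor with p is inverted directly; those with q and \<alpha> are multiplied on by
  \<open>mellin_inversion_mult\<close>. The bounds involving c give convergence on the line Re s =
  c, while p > -1, q > -1 and \<alpha> < 1 give it at s = n + 1, where the moments are read
  off.\<close>

lemma meijer_density_exists:
  assumes \<alpha>: "0 \<le> \<alpha>" "\<alpha> < 1" "\<alpha> < c" and p: "p > -1" "c + p > 0" and q: "q > -1" "c + q > 0"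
  obtains g :: "real \<Rightarrow> real" where "g \<in> borel_measurable borel" "\<And>r. g r \<ge> 0" "\<And>r. r \<le> 0 \<Longrightarrow> g r = 0"
    "\<And>r. r > 0 \<Longrightarrow> (LINT t|lborel. Gamma (of_real p + Complex c t) * Gamma (of_real q + Complex c t)
        * (Gamma (Complex c t - of_real \<alpha>) / Gamma (Complex c t)) * mpow r (- Complex c t))
       = complex_of_real (2 * pi * g r)"
    "\<And>n. (\<integral>\<^sup>+r. ennreal (g r * r ^ n) \<partial>lborel)
       = ennreal (Gamma (p + n + 1) * Gamma (q + n + 1) * (Gamma (n + 1 - \<alpha>) / Gamma (n + 1)))"
proof -
  let ?F = "\<lambda>t. Gamma (of_real p + Complex c t) * Gamma (of_real q + Complex c t)"
  let ?B = "\<lambda>t. Gamma (Complex c t - of_real \<alpha>) / Gamma (Complex c t)"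
  define g0 where "g0 = gamma_weight (p + 1)"
  define g1 where "g1 = mult_conv (gamma_weight q) g0"
  have g0: "g0 \<in> borel_measurable borel" "g0 r \<ge> 0" "r \<le> 0 \<Longrightarrow> g0 r = 0" for r
    by (simp_all add: g0_def gamma_weight_nonneg gamma_weight_nonpos)
  have g1 [measurable]: "g1 \<in> borel_measurable borel" and g1_nonneg: "g1 r \<ge> 0"
    and g1_nonpos: "r \<le> 0 \<Longrightarrow> g1 r = 0" for r
    unfolding g1_def
    by (auto intro: measurable_mult_conv mult_conv_nonneg mult_conv_nonpos gamma_weight_nonneg gamma_weight_nonpos g0)
  have B1: "has_bochner_integral lborel (\<lambda>u. complex_of_real (gamma_weight q u) * mpow u (Complex c t))
      (Gamma (of_real q + Complex c t))" for t
    using q by (intro has_bochner_integral_gamma_weight) simp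
  note raw1 = mellin_inversion_mult[OF gamma_weight_measurable gamma_weight_nonneg gamma_weight_nonpos
    Gamma_shift_inverse_mellin[OF p(2)] B1]
  have inv1: "integrable lborel ?F"
      "r > 0 \<Longrightarrow> integrable lborel (\<lambda>u. gamma_weight q u * g0 (r / u))"
      "r > 0 \<Longrightarrow> (LINT t|lborel. ?F t * mpow r (- Complex c t)) = complex_of_real (2 * pi * g1 r)" for r
    unfolding g1_def mult_conv_def g0_def by (rule raw1; simp)+
  have mom1: "(\<integral>\<^sup>+r. ennreal (g1 r * r ^ n) \<partial>lborel) = ennreal (Gamma (p + n + 1) * Gamma (q + n + 1))" for n
  proof -
    have "(\<integral>\<^sup>+r. ennreal (g1 r * r ^ n) \<partial>lborel)
        = (\<integral>\<^sup>+u. ennreal (gamma_weight q u * u ^ Suc n) \<partial>lborel) * (\<integral>\<^sup>+x. ennreal (g0 x * x ^ n) \<partial>lborel)"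
      unfolding g1_def mult_conv_def
      by (rule nn_moment_mult) (auto intro: g0 inv1(2) gamma_weight_nonneg gamma_weight_nonpos)
    also have "(\<integral>\<^sup>+u. ennreal (gamma_weight q u * u ^ Suc n) \<partial>lborel) = ennreal (Gamma (q + Suc n))"
      using q by (intro nn_integral_gamma_weight_power) simp
    also have "(\<integral>\<^sup>+x. ennreal (g0 x * x ^ n) \<partial>lborel) = ennreal (Gamma (p + 1 + n))"
      unfolding g0_def using p by (intro nn_integral_gamma_weight_power) simp
    finally show ?thesis
      using p q by (simp add: ennreal_mult'[symmetric] Gamma_real_pos less_imp_le add_ac mult.commute)
  qed
  show thesis
  \<comment> \<open>\<open>beta_weight 0\<close> is no density for the unit mass at 1. In this case
    the quotient is 1 on the line, since Gamma has no zeros and no poles there.\<close>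
  proof (cases "\<alpha> = 0")
    case True
    have "Complex c t \<notin> \<int>\<^sub>\<le>\<^sub>0" for t
      using \<alpha> by (auto simp: complex_eq_iff elim!: nonpos_Ints_cases)
    then have "Gamma (Complex c t) \<noteq> 0" for t
      by (simp add: Gamma_eq_zero_iff)
    then have B0: "?B t = 1" for t
      using True by simp
    show thesis
    proof (rule that[OF g1 g1_nonneg g1_nonpos])
      show "(LINT t|lborel. ?F t * ?B t * mpow r (- Complex c t)) = complex_of_real (2 * pi * g1 r)"
        if "r > 0" for r
        using inv1(3)[OF that] unfolding B0 by simp
      have "Gamma (real n + 1) > 0" for n
        by (rule Gamma_real_pos) simp
      then show "(\<integral>\<^sup>+r. ennreal (g1 r * r ^ n) \<partial>lborel)
       = ennreal (Gamma (p + n + 1) * Gamma (q + n + 1) * (Gamma (n + 1 - \<alpha>) / Gamma (n + 1)))" for n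
        using mom1[of n] True by (simp add: less_imp_neq[THEN not_sym])
    qed
  next
    case False
    then have \<alpha>0: "\<alpha> > 0" using \<alpha> by simp
    define g2 where "g2 = mult_conv (beta_weight \<alpha>) g1"
    have B2: "has_bochner_integral lborel (\<lambda>u. complex_of_real (beta_weight \<alpha> u) * mpow u (Complex c t)) (?B t)" for t
      using \<alpha> \<alpha>0 by (intro has_bochner_integral_beta_weight) auto
    note raw2 = mellin_inversion_mult[OF beta_weight_measurable beta_weight_nonneg[OF \<alpha>0] beta_weight_nonpos
      inv1(1,3) B2]
    have inv2: "r > 0 \<Longrightarrow> integrable lborel (\<lambda>u. beta_weight \<alpha> u * g1 (r / u))"
      "r > 0 \<Longrightarrow> (LINT t|lborel. ?F t * ?B t * mpow r (- Complex c t)) = complex_of_real (2 * pi * g2 r)" for r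
      unfolding g2_def mult_conv_def by (rule raw2; simp)+
    have g2: "g2 \<in> borel_measurable borel" "g2 r \<ge> 0" "r \<le> 0 \<Longrightarrow> g2 r = 0" for r
      unfolding g2_def using \<alpha>0
      by (auto intro: measurable_mult_conv mult_conv_nonneg mult_conv_nonpos beta_weight_nonneg beta_weight_nonpos g1 g1_nonneg g1_nonpos)
    show thesis
    proof (rule that[OF g2])
      show "(LINT t|lborel. ?F t * ?B t * mpow r (- Complex c t)) = complex_of_real (2 * pi * g2 r)"
        if "r > 0" for r
        by (rule inv2(2)[OF that])
      show "(\<integral>\<^sup>+r. ennreal (g2 r * r ^ n) \<partial>lborel)
       = ennreal (Gamma (p + n + 1) * Gamma (q + n + 1) * (Gamma (n + 1 - \<alpha>) / Gamma (n + 1)))" for n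
      proof -
        have "(\<integral>\<^sup>+r. ennreal (g2 r * r ^ n) \<partial>lborel)
            = (\<integral>\<^sup>+u. ennreal (beta_weight \<alpha> u * u ^ Suc n) \<partial>lborel) * (\<integral>\<^sup>+x. ennreal (g1 x * x ^ n) \<partial>lborel)"
          unfolding g2_def mult_conv_def
          by (rule nn_moment_mult) (auto intro: g1 g1_nonneg g1_nonpos inv2(1) beta_weight_nonneg[OF \<alpha>0] beta_weight_nonpos)
        also have "(\<integral>\<^sup>+u. ennreal (beta_weight \<alpha> u * u ^ Suc n) \<partial>lborel) = ennreal (Gamma (Suc n - \<alpha>) / Gamma (Suc n))"
          using \<alpha> \<alpha>0 by (intro nn_integral_beta_weight_power) auto
        also note mom1
        finally show ?thesis
          using p q \<alpha> by (simp add: ennreal_mult'[symmetric] Gamma_real_pos less_imp_le add_ac mult.commute)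
      qed
    qed
  qed
qed

section \<open>Complex Hilbert spaces\<close>

lemma cinner_add_left: "cinner (x + y) z = cinner x z + cinner y z"
  by (metis cinner_add_right cinner_commute complex_cnj_add)

lemma cinner_scaleC_left: "cinner (a *\<^sub>C x) y = cnj a * cinner x y"
  by (metis cinner_commute cinner_scaleC_right complex_cnj_mult)

lemma cinner_scaleR_right: "cinner x (r *\<^sub>R y) = of_real r * cinner x y"
  by (simp add: scaleR_scaleC cinner_scaleC_right)

lemma cinner_zero_right [simp]: "cinner x 0 = 0"
  by (metis add_cancel_right_right cinner_add_right)

lemma cinner_zero_left [simp]: "cinner 0 x = 0"
  by (metis add_cancel_right_right cinner_add_left)

lemma cinner_diff_right: "cinner x (y - z) = cinner x y - cinner x z"
  by (metis add_diff_cancel cinner_add_right diff_add_cancel)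

lemma cinner_diff_left: "cinner (x - y) z = cinner x z - cinner y z"
  by (metis add_diff_cancel cinner_add_left diff_add_cancel)

lemma cinner_sum_right: "cinner x (\<Sum>i\<in>A. f i) = (\<Sum>i\<in>A. cinner x (f i))"
  by (induction A rule: infinite_finite_induct) (simp_all add: cinner_add_right)

lemma cinner_sum_left: "cinner (\<Sum>i\<in>A. f i) x = (\<Sum>i\<in>A. cinner (f i) x)"
  by (induction A rule: infinite_finite_induct) (simp_all add: cinner_add_left)

lemma cinner_mult_commute: "cinner x y * cinner y x = of_real ((cmod (cinner x y))\<^sup>2)"
  by (subst cinner_commute[of y x]) (simp only: complex_norm_square)

lemma norm_cinner_le: "cmod (cinner x y) \<le> norm x * norm y"
proof (cases "y = 0")
  case False
  \<comment> \<open>\<open>a *\<^sub>C y\<close> is the orthogonal projection of x onto the line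
    through y; the claim is that the squared norm of the remainder is nonnegative.\<close>
  define a where "a = cinner y x / of_real ((norm y)\<^sup>2)"
  have ny: "norm y > 0" using False by simp
  have "complex_of_real ((norm (x - a *\<^sub>C y))\<^sup>2)
      = cinner x x - a * cinner x y - cnj a * cinner y x + cnj a * a * cinner y y"
    unfolding cinner_self[symmetric]
    by (simp add: cinner_diff_left cinner_diff_right cinner_scaleC_left cinner_scaleC_right algebra_simps)
  also have "a * cinner x y = of_real ((cmod (cinner x y))\<^sup>2 / (norm y)\<^sup>2)"
    using cinner_mult_commute[of x y] by (simp add: a_def mult.commute)
  also have "cnj a * cinner y x = of_real ((cmod (cinner x y))\<^sup>2 / (norm y)\<^sup>2)"
    using cinner_mult_commute[of x y] by (simp add: a_def cinner_commute[of x y])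
  also have "cnj a * a * cinner y y = of_real ((cmod (cinner x y))\<^sup>2 / (norm y)\<^sup>2)"
    using ny cinner_mult_commute[of x y]
    by (simp add: a_def cinner_self cinner_commute[of x y] power2_eq_square field_simps)
  also have "cinner x x - of_real ((cmod (cinner x y))\<^sup>2 / (norm y)\<^sup>2)
      - of_real ((cmod (cinner x y))\<^sup>2 / (norm y)\<^sup>2) + of_real ((cmod (cinner x y))\<^sup>2 / (norm y)\<^sup>2)
      = complex_of_real ((norm x)\<^sup>2 - (cmod (cinner x y))\<^sup>2 / (norm y)\<^sup>2)"
    by (simp add: cinner_self)
  finally have "(norm (x - a *\<^sub>C y))\<^sup>2 = (norm x)\<^sup>2 - (cmod (cinner x y))\<^sup>2 / (norm y)\<^sup>2"
    by (simp only: of_real_eq_iff)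
  then have "(cmod (cinner x y))\<^sup>2 / (norm y)\<^sup>2 \<le> (norm x)\<^sup>2"
    by (metis diff_ge_0_iff_ge zero_le_power2)
  then have "(cmod (cinner x y))\<^sup>2 \<le> (norm x * norm y)\<^sup>2"
    using ny by (simp add: field_simps power_mult_distrib)
  then show ?thesis
    by (rule power2_le_imp_le) simp
qed simp

lemma bounded_linear_cinner_right: "bounded_linear (cinner x)"
proof (rule bounded_linear_intro[where K = "norm x"])
  show "norm (cinner x y) \<le> norm y * norm x" for y
    using norm_cinner_le[of x y] by (simp add: mult.commute)
qed (simp_all add: cinner_add_right cinner_scaleR_right scaleR_conv_of_real)

lemma norm_scaleC: "norm (a *\<^sub>C (x :: 'a::complex_hilbert_space)) = cmod a * norm x"
proof -
  have "complex_of_real ((norm (a *\<^sub>C x))\<^sup>2) = cinner (a *\<^sub>C x) (a *\<^sub>C x)"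
    by (simp only: cinner_self)
  also have "\<dots> = (a * cnj a) * cinner x x"
    by (simp add: cinner_scaleC_left cinner_scaleC_right mult_ac)
  also have "\<dots> = complex_of_real ((cmod a * norm x)\<^sup>2)"
    by (simp only: cinner_self complex_norm_square[symmetric] of_real_mult power_mult_distrib)
  finally show ?thesis
    by (simp only: of_real_eq_iff power2_eq_iff_nonneg norm_ge_zero mult_nonneg_nonneg)
qed

text \<open>The signs of the \<i>-terms follow conjugate-linearity in the first argument, so that
  this identity and \<open>cinner_polarization\<close> have the same shape term by term.\<close>

lemma polarization: "cnj x * y = 
  (of_real ((cmod (x + y))\<^sup>2) - of_real ((cmod (x - y))\<^sup>2)
    + \<i> * (of_real ((cmod (x - \<i> * y))\<^sup>2) - of_real ((cmod (x + \<i> * y))\<^sup>2))) / 4"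
  by (simp add: complex_eq_iff cmod_power2) (simp add: power2_eq_square algebra_simps)

lemma cinner_polarization: "cinner x y = 
  (of_real ((norm (x + y))\<^sup>2) - of_real ((norm (x - y))\<^sup>2)
    + \<i> * (of_real ((norm (x - \<i> *\<^sub>C y))\<^sup>2) - of_real ((norm (x + \<i> *\<^sub>C y))\<^sup>2))) / 4"
  unfolding cinner_self[symmetric]
  by (simp add: cinner_add_left cinner_add_right cinner_diff_left cinner_diff_right
      cinner_scaleC_left cinner_scaleC_right algebra_simps)

text \<open>Polarization on both sides: the hypothesis is applied to f + g, f - g, f - \<i> g and f
  + \<i> g, and the four integrals recombine linearly.\<close>

lemma resolution_of_identity_if_norm:
  assumes "\<And>h. has_bochner_integral M (\<lambda>z. (cmod (cinner (v z) h))\<^sup>2) ((norm h)\<^sup>2)"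
  shows "resolution_of_identity M v"
proof -
  have eq: "cinner f (v z) * cinner (v z) g =
    (of_real ((cmod (cinner (v z) (f + g)))\<^sup>2) - of_real ((cmod (cinner (v z) (f - g)))\<^sup>2)
    + \<i> * (of_real ((cmod (cinner (v z) (f - \<i> *\<^sub>C g)))\<^sup>2) - of_real ((cmod (cinner (v z) (f + \<i> *\<^sub>C g)))\<^sup>2))) / 4" for f g z
    using polarization[of "cinner (v z) f" "cinner (v z) g"]
    by (simp add: cinner_add_right cinner_diff_right cinner_scaleC_right cinner_commute[of f "v z"])
  have "has_bochner_integral M (\<lambda>z. cinner f (v z) * cinner (v z) g) (cinner f g)" for f g
    unfolding eq cinner_polarization[of f g]
    by (intro has_bochner_integral_divide_zero has_bochner_integral_add has_bochner_integral_diff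
        has_bochner_integral_mult_right has_bochner_integral_of_real assms)
  then show ?thesis
    by (simp add: resolution_of_identity_def has_bochner_integral_iff)
qed

section \<open>Expansion in the orthonormal basis\<close>

lemma span_range_nat:
  fixes \<psi> :: "nat \<Rightarrow> 'a::complex_hilbert_space"
  assumes "y \<in> complex_vector.span (range \<psi>)"
  obtains N b where "y = (\<Sum>n<N. b n *\<^sub>C \<psi> n)"
proof -
  have "\<exists>N b. y = (\<Sum>n<N. b n *\<^sub>C \<psi> n)"
    using assms
  proof (induction rule: complex_vector.span_induct_alt)
    case base
    show ?case by (intro exI[of _ "0::nat"]) simp
  next
    case (step a x y)
    then obtain N b k where y: "y = (\<Sum>n<N. b n *\<^sub>C \<psi> n)" and x: "x = \<psi> k" by blast
    \<comment> \<open>A common length for both sums, large enough to contain the index k;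
      coefficients are padded with zeros.\<close>
    define M where "M = max N (Suc k)"
    have "y = (\<Sum>n<M. (if n < N then b n else 0) *\<^sub>C \<psi> n)"
      unfolding y by (intro sum.mono_neutral_cong_left) (auto simp: M_def)
    moreover have "a *\<^sub>C x = (\<Sum>n<M. (if n = k then a else 0) *\<^sub>C \<psi> n)"
    proof -
      have "(\<Sum>n<M. (if n = k then a else 0) *\<^sub>C \<psi> n) = (\<Sum>n<M. if n = k then a *\<^sub>C \<psi> n else 0)"
        by (intro sum.cong) auto
      moreover have "k < M" by (simp add: M_def)
      ultimately show ?thesis by (simp add: x)
    qed
    ultimately have "a *\<^sub>C x + y = (\<Sum>n<M. ((if n = k then a else 0) + (if n < N then b n else 0)) *\<^sub>C \<psi> n)"
      by (simp add: sum.distrib complex_vector.scale_left_distrib)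
    then show ?case
      by (intro exI[of _ M] exI[of _ "\<lambda>n. (if n = k then a else 0) + (if n < N then b n else 0)"])
  qed
  then show thesis using that by blast
qed

text \<open>Completing the square in each coordinate. The choice b n =
  \<open>cinner (\<psi> n) h\<close> yields Bessel's inequality; arbitrary b shows that no
  combination of the first N vectors approximates h better than the Fourier sum.\<close>

lemma norm_diff_orthonormal:
  fixes \<psi> :: "nat \<Rightarrow> 'a::complex_hilbert_space"
  assumes "\<And>m n. cinner (\<psi> m) (\<psi> n) = (if m = n then 1 else 0)"
  shows "(norm (h - (\<Sum>n<N. b n *\<^sub>C \<psi> n)))\<^sup>2
    = (norm h)\<^sup>2 - (\<Sum>n<N. (cmod (cinner (\<psi> n) h))\<^sup>2) + (\<Sum>n<N. (cmod (cinner (\<psi> n) h - b n))\<^sup>2)"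
proof -
  let ?y = "\<Sum>n<N. b n *\<^sub>C \<psi> n"
  have yy: "cinner ?y ?y = (\<Sum>n<N. b n * cnj (b n))"
  proof -
    have "cinner ?y ?y = (\<Sum>n<N. \<Sum>m<N. if m = n then cnj (b n) * b m else 0)"
      unfolding cinner_sum_left
      by (simp add: cinner_sum_right cinner_scaleC_left cinner_scaleC_right assms if_distrib sum_distrib_left mult_ac cong: if_cong)
    then show ?thesis by (simp add: mult.commute)
  qed
  have "complex_of_real ((norm (h - ?y))\<^sup>2) = cinner h h - cinner h ?y - cinner ?y h + cinner ?y ?y"
    unfolding cinner_self[symmetric] by (simp add: cinner_diff_left cinner_diff_right)
  also have "\<dots> = of_real ((norm h)\<^sup>2) + (\<Sum>n<N. - (b n * cnj (cinner (\<psi> n) h)) - cnj (b n) * cinner (\<psi> n) h + b n * cnj (b n))"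
    unfolding yy unfolding cinner_self
    by (simp add: cinner_sum_left cinner_sum_right cinner_scaleC_left cinner_scaleC_right
        sum.distrib sum_subtractf sum_negf cinner_commute[of h])
  also have "(\<Sum>n<N. - (b n * cnj (cinner (\<psi> n) h)) - cnj (b n) * cinner (\<psi> n) h + b n * cnj (b n))
     = (\<Sum>n<N. of_real ((cmod (cinner (\<psi> n) h - b n))\<^sup>2) - of_real ((cmod (cinner (\<psi> n) h))\<^sup>2))"
    unfolding complex_norm_square by (intro sum.cong refl) (simp add: algebra_simps)
  finally have "complex_of_real ((norm (h - ?y))\<^sup>2) = complex_of_real ((norm h)\<^sup>2
      + (\<Sum>n<N. (cmod (cinner (\<psi> n) h - b n))\<^sup>2 - (cmod (cinner (\<psi> n) h))\<^sup>2))"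
    by simp
  then show ?thesis
    by (simp only: of_real_eq_iff sum_subtractf)
qed

text \<open>Density supplies a finite combination y close to h. The Fourier sum of the same length
  is at least as close, so the partial sums, which increase and are bounded by Bessel, come within e
  of their bound.\<close>

lemma parseval:
  assumes "orthonormal_basis \<psi>"
  shows "(\<lambda>n. (cmod (cinner (\<psi> n) h))\<^sup>2) sums (norm h)\<^sup>2"
proof -
  let ?c = "\<lambda>n. (cmod (cinner (\<psi> n) h))\<^sup>2"
  have orth: "\<And>m n. cinner (\<psi> m) (\<psi> n) = (if m = n then 1 else 0)"
    and dense: "closure (complex_vector.span (range \<psi>)) = UNIV"
    using assms by (auto simp: orthonormal_basis_def)
  have le: "(\<Sum>n<N. ?c n) \<le> (norm h)\<^sup>2" for N
    using norm_diff_orthonormal[OF orth, where h = h and N = N and b = "\<lambda>n. cinner (\<psi> n) h"]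
      zero_le_power2[of "norm (h - (\<Sum>n<N. cinner (\<psi> n) h *\<^sub>C \<psi> n))"] by simp
  have "(\<lambda>N. \<Sum>n<N. ?c n) \<longlonglongrightarrow> (norm h)\<^sup>2"
  proof (rule LIMSEQ_I)
    fix e :: real assume e: "e > 0"
    have "h \<in> closure (complex_vector.span (range \<psi>))" using dense by simp
    then obtain y where y: "y \<in> complex_vector.span (range \<psi>)" "dist y h < sqrt e"
      using e closure_approachable[of h "complex_vector.span (range \<psi>)"] by (meson real_sqrt_gt_zero)
    obtain N b where N: "y = (\<Sum>n<N. b n *\<^sub>C \<psi> n)"
      using span_range_nat[OF y(1)] .
    have "(norm (h - y))\<^sup>2 < e"
      using y(2) e by (metis abs_norm_cancel dist_commute dist_norm real_sqrt_abs real_sqrt_less_iff)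
    then have "(norm h)\<^sup>2 - (\<Sum>n<N. ?c n) < e"
      using norm_diff_orthonormal[OF orth, where h = h and N = N and b = b] sum_nonneg[of "{..<N}" "\<lambda>n. (cmod (cinner (\<psi> n) h - b n))\<^sup>2"]
      unfolding N by simp
    moreover have "(\<Sum>n<N. ?c n) \<le> (\<Sum>n<M. ?c n)" if "M \<ge> N" for M
      using that by (intro sum_mono2) auto
    ultimately have "norm ((\<Sum>n<M. ?c n) - (norm h)\<^sup>2) < e" if "M \<ge> N" for M
      using le[of M] that by (smt (verit) real_norm_def)
    then show "\<exists>N. \<forall>M\<ge>N. norm ((\<Sum>n<M. ?c n) - (norm h)\<^sup>2) < e" by blast
  qed
  then show ?thesis by (simp add: sums_def)
qed

section \<open>Parseval on the circle\<close>

lemma has_bochner_integral_cis: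
  fixes k :: int
  shows "has_bochner_integral lborel (\<lambda>\<theta>. indicator {0..2 * pi} \<theta> *\<^sub>R cis (of_int k * \<theta>)) (if k = 0 then 2 * pi else 0)"
proof (cases "k = 0")
  case True
  have "has_bochner_integral lborel (\<lambda>\<theta>::real. indicator {0..2 * pi} \<theta> *\<^sub>R (1::complex))
    (measure lborel {0..2 * pi} *\<^sub>R 1)"
    by (rule has_bochner_integral_indicator) auto
  then show ?thesis using True by (simp add: scaleR_conv_of_real)
next
  case False
  have "has_bochner_integral lborel (\<lambda>\<theta>. indicator {0..2 * pi} \<theta> *\<^sub>R cis (of_int k * \<theta>))
     (cis (of_int k * (2 * pi)) / (\<i> * of_int k) - cis (of_int k * 0) / (\<i> * of_int k))"
  proof (rule has_bochner_integral_FTC_Icc)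
    fix x :: real
    have "((\<lambda>z. exp (\<i> * of_int k * z) / (\<i> * of_int k)) has_field_derivative exp (\<i> * of_int k * of_real x)) (at (of_real x))"
      using False by (auto intro!: derivative_eq_intros)
    then have "((\<lambda>x. exp (\<i> * of_int k * of_real x) / (\<i> * of_int k)) has_vector_derivative exp (\<i> * of_int k * of_real x)) (at x)"
      by (rule has_vector_derivative_real_field)
    then show "((\<lambda>\<theta>. cis (of_int k * \<theta>) / (\<i> * of_int k)) has_vector_derivative cis (of_int k * x)) (at x within {0..2 * pi})"
      by (simp add: cis_conv_exp mult.assoc has_vector_derivative_at_within)
  qed (auto intro!: continuous_intros)
  moreover have "cis (of_int k * (2 * pi)) = 1"
    using cis_multiple_2pi[of "of_int k"] by (simp add: mult_ac)
  ultimately show ?thesis using False by simp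
qed

lemma circle_parseval_finite:
  fixes c :: "nat \<Rightarrow> complex"
  shows "has_bochner_integral lborel (\<lambda>\<theta>. indicator {0..2 * pi} \<theta> * (cmod (\<Sum>n<N. c n * cis (n * \<theta>)))\<^sup>2)
    (2 * pi * (\<Sum>n<N. (cmod (c n))\<^sup>2))"
proof -
  have eq: "complex_of_real (indicator {0..2 * pi} \<theta> * (cmod (\<Sum>n<N. c n * cis (n * \<theta>)))\<^sup>2)
    = (\<Sum>m<N. \<Sum>n<N. c m * cnj (c n) * (indicator {0..2 * pi} \<theta> *\<^sub>R cis (of_int (int m - int n) * \<theta>)))" for \<theta> :: real
  proof -
    have "cis (of_int (int m - int n) * \<theta>) = cis (m * \<theta>) * cnj (cis (n * \<theta>))" for m n
      by (simp add: cis_cnj cis_mult algebra_simps)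
    then show ?thesis
      unfolding of_real_mult complex_norm_square cnj_sum sum_product
      by (simp add: sum_distrib_left scaleR_conv_of_real mult_ac)
  qed
  have "has_bochner_integral lborel
     (\<lambda>\<theta>. complex_of_real (indicator {0..2 * pi} \<theta> * (cmod (\<Sum>n<N. c n * cis (n * \<theta>)))\<^sup>2))
     (\<Sum>m<N. \<Sum>n<N. c m * cnj (c n) * (if int m - int n = 0 then 2 * pi else 0))"
    unfolding eq
    by (intro has_bochner_integral_sum has_bochner_integral_mult_right) (rule has_bochner_integral_cis)
  also have "(\<Sum>m<N. \<Sum>n<N. c m * cnj (c n) * complex_of_real (if int m - int n = 0 then 2 * pi else 0))
    = (\<Sum>m<N. \<Sum>n<N. if n = m then c m * cnj (c m) * (2 * pi) else 0)"
    by (intro sum.cong) auto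
  also have "\<dots> = complex_of_real (2 * pi * (\<Sum>n<N. (cmod (c n))\<^sup>2))"
    by (simp add: complex_norm_square sum_distrib_left mult_ac del: of_real_power)
  finally show ?thesis
    by (simp only: has_bochner_integral_iff complex_of_real_integrable_eq integral_complex_of_real of_real_eq_iff)
qed

text \<open>The terms are eventually below 1, where squaring only decreases them.\<close>

lemma summable_norm_power2:
  fixes c :: "nat \<Rightarrow> complex"
  assumes "summable (\<lambda>n. cmod (c n))"
  shows "summable (\<lambda>n. (cmod (c n))\<^sup>2)"
  by (rule summable_comparison_test_ev[OF _ assms])
     (use summable_LIMSEQ_zero[OF assms] in \<open>auto dest!: order_tendstoD(2)[of _ 0 _ 1] elim!: eventually_mono simp: power2_eq_square intro: mult_left_le_one_le\<close>)

text \<open>Passage to the limit from trigonometric polynomials: absolute summability bounds all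
  partial sums by one constant, which is integrable over the bounded interval.\<close>

lemma circle_parseval:
  fixes c :: "nat \<Rightarrow> complex"
  assumes c: "summable (\<lambda>n. cmod (c n))"
  shows "(\<integral>\<^sup>+\<theta>. ennreal ((cmod (\<Sum>n. c n * cis (n * \<theta>)))\<^sup>2) * indicator {0..<2 * pi} \<theta> \<partial>lborel)
    = ennreal (2 * pi) * (\<Sum>n. ennreal ((cmod (c n))\<^sup>2))"
proof -
  let ?P = "\<lambda>\<theta>::real. \<Sum>n. c n * cis (n * \<theta>)" and ?Q = "\<lambda>N (\<theta>::real). \<Sum>n<N. c n * cis (n * \<theta>)"
  let ?S = "\<Sum>n. cmod (c n)"
  let ?I = "indicator {0..2 * pi} :: real \<Rightarrow> real"
  have sm: "summable (\<lambda>n. c n * cis (n * \<theta>))" for \<theta> :: real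
    by (rule summable_norm_cancel) (use c in \<open>simp add: norm_mult\<close>)
  have sq: "summable (\<lambda>n. (cmod (c n))\<^sup>2)"
    using c by (rule summable_norm_power2)
  have lim: "(\<lambda>N. ?Q N \<theta>) \<longlonglongrightarrow> ?P \<theta>" for \<theta> :: real
    using sm by (rule summable_LIMSEQ)
  have bd: "cmod (?Q N \<theta>) \<le> ?S" for N \<theta>
  proof -
    have "cmod (?Q N \<theta>) \<le> (\<Sum>n<N. cmod (c n))"
      by (rule order_trans[OF norm_sum]) (simp add: norm_mult)
    also have "\<dots> \<le> ?S" using c by (intro sum_le_suminf) auto
    finally show ?thesis .
  qed
  have [measurable]: "?P \<in> borel_measurable borel"
    by (intro borel_measurable_suminf borel_measurable_continuous_onI continuous_intros)
  have [measurable]: "?Q N \<in> borel_measurable borel" for N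
    by (intro borel_measurable_continuous_onI continuous_intros)
  have w: "integrable lborel (\<lambda>\<theta>. ?I \<theta> * ?S\<^sup>2)"
    by (intro integrable_mult_left integrable_real_indicator) auto
  have ae_lim: "AE \<theta> in lborel. (\<lambda>N. ?I \<theta> * (cmod (?Q N \<theta>))\<^sup>2) \<longlonglongrightarrow> ?I \<theta> * (cmod (?P \<theta>))\<^sup>2"
    by (intro AE_I2 tendsto_intros lim)
  have ae_bd: "AE \<theta> in lborel. norm (?I \<theta> * (cmod (?Q N \<theta>))\<^sup>2) \<le> ?I \<theta> * ?S\<^sup>2" for N
    using bd by (intro AE_I2) (auto simp: indicator_def intro!: power_mono)
  have int: "integrable lborel (\<lambda>\<theta>. ?I \<theta> * (cmod (?P \<theta>))\<^sup>2)"
    by (rule integrable_dominated_convergence[OF _ _ w ae_lim ae_bd]) measurable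
  have lim': "(\<lambda>N. LINT \<theta>|lborel. ?I \<theta> * (cmod (?Q N \<theta>))\<^sup>2) \<longlonglongrightarrow> (LINT \<theta>|lborel. ?I \<theta> * (cmod (?P \<theta>))\<^sup>2)"
    by (rule integral_dominated_convergence[OF _ _ w ae_lim ae_bd]) measurable
  have "(\<lambda>N. 2 * pi * (\<Sum>n<N. (cmod (c n))\<^sup>2)) \<longlonglongrightarrow> (LINT \<theta>|lborel. ?I \<theta> * (cmod (?P \<theta>))\<^sup>2)"
    using lim' circle_parseval_finite[of c] by (simp add: has_bochner_integral_iff)
  moreover have "(\<lambda>N. 2 * pi * (\<Sum>n<N. (cmod (c n))\<^sup>2)) \<longlonglongrightarrow> 2 * pi * (\<Sum>n. (cmod (c n))\<^sup>2)"
    by (intro tendsto_mult_left summable_LIMSEQ sq)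
  ultimately have val: "(LINT \<theta>|lborel. ?I \<theta> * (cmod (?P \<theta>))\<^sup>2) = 2 * pi * (\<Sum>n. (cmod (c n))\<^sup>2)"
    by (rule LIMSEQ_unique)
  \<comment> \<open>The half-open interval of the polar angle and the closed one of the Fourier
    integrals differ in a null set.\<close>
  have "(\<integral>\<^sup>+\<theta>. ennreal ((cmod (?P \<theta>))\<^sup>2) * indicator {0..<2 * pi} \<theta> \<partial>lborel)
      = (\<integral>\<^sup>+\<theta>. ennreal (?I \<theta> * (cmod (?P \<theta>))\<^sup>2) \<partial>lborel)"
    using AE_lborel_singleton[of "2 * pi"]
    by (intro nn_integral_cong_AE) (auto elim!: eventually_mono simp: indicator_def)
  also have "\<dots> = ennreal (2 * pi * (\<Sum>n. (cmod (c n))\<^sup>2))"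
    using int by (subst nn_integral_eq_integral) (auto simp: val)
  also have "\<dots> = ennreal (2 * pi) * (\<Sum>n. ennreal ((cmod (c n))\<^sup>2))"
    using sq by (simp add: ennreal_mult' suminf_ennreal2)
  finally show ?thesis .
qed

section \<open>Coherent states\<close>

text \<open>The substitution r = x^2 on compact intervals, extended by monotone convergence along
  [0, N] and its image [0, N^2].\<close>

lemma nn_integral_square_substitution:
  fixes f :: "real \<Rightarrow> ennreal"
  assumes [measurable]: "f \<in> borel_measurable borel"
  shows "(\<integral>\<^sup>+r. f r * indicator {0<..} r \<partial>lborel) = (\<integral>\<^sup>+x. f (x\<^sup>2) * ennreal (2 * x) * indicator {0<..} x \<partial>lborel)"
proof -
  have "(\<lambda>N::nat. \<integral>\<^sup>+r. f r * indicator {0..(real N)\<^sup>2} r \<partial>lborel) \<longlonglongrightarrow> (\<integral>\<^sup>+r. f r * indicator {0..} r \<partial>lborel)"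
  proof (rule nn_integral_LIMSEQ)
    have "(real m)\<^sup>2 \<le> (real n)\<^sup>2" if "m \<le> n" for m n
      using that by (intro power_mono) auto
    then show "incseq (\<lambda>(N::nat) r. f r * indicator {0..(real N)\<^sup>2} r)"
      by (force simp: incseq_def le_fun_def indicator_def intro: order_trans)
    fix r :: real
    obtain N :: nat where N: "max 1 r < N" using reals_Archimedean2 by blast
    have "\<forall>\<^sub>F M::nat in sequentially. f r * indicator {0..(real M)\<^sup>2} r = f r * indicator {0..} r"
      using eventually_ge_at_top[of N]
    proof eventually_elim
      case (elim M)
      have "r \<le> real M * 1" using N elim by simp
      also have "\<dots> \<le> real M * real M" using N elim by (intro mult_left_mono) auto
      finally have "r \<le> (real M)\<^sup>2" by (simp add: power2_eq_square)
      then show ?case by (simp add: indicator_def)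
    qed
    then show "(\<lambda>M::nat. f r * indicator {0..(real M)\<^sup>2} r) \<longlonglongrightarrow> f r * indicator {0..} r"
      by (rule tendsto_eventually)
  qed measurable
  moreover have "(\<lambda>N::nat. \<integral>\<^sup>+x. f (x\<^sup>2) * ennreal (2 * x) * indicator {0..real N} x \<partial>lborel)
      \<longlonglongrightarrow> (\<integral>\<^sup>+x. f (x\<^sup>2) * ennreal (2 * x) * indicator {0..} x \<partial>lborel)"
  proof (rule nn_integral_LIMSEQ)
    show "incseq (\<lambda>(N::nat) x. f (x\<^sup>2) * ennreal (2 * x) * indicator {0..real N} x)"
      by (force simp: incseq_def le_fun_def indicator_def intro: order_trans)
    fix x :: real
    obtain N :: nat where N: "x < N" using reals_Archimedean2 by blast
    have "\<forall>\<^sub>F M::nat in sequentially. f (x\<^sup>2) * ennreal (2 * x) * indicator {0..real M} x = f (x\<^sup>2) * ennreal (2 * x) * indicator {0..} x"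
      using eventually_ge_at_top[of N] by eventually_elim (use N in \<open>simp add: indicator_def\<close>)
    then show "(\<lambda>M::nat. f (x\<^sup>2) * ennreal (2 * x) * indicator {0..real M} x) \<longlonglongrightarrow> f (x\<^sup>2) * ennreal (2 * x) * indicator {0..} x"
      by (rule tendsto_eventually)
  qed measurable
  moreover have "(\<integral>\<^sup>+r. f r * indicator {0..(real N)\<^sup>2} r \<partial>lborel)
      = (\<integral>\<^sup>+x. f (x\<^sup>2) * ennreal (2 * x) * indicator {0..real N} x \<partial>lborel)" for N :: nat
  \<comment> \<open>Both intervals then shrink to the null set {0}; the substitution rule is applied
    to nondegenerate intervals.\<close>
  proof (cases "N = 0")
    case True
    have "(\<integral>\<^sup>+r. f r * indicator {0..(real N)\<^sup>2} r \<partial>lborel) = (\<integral>\<^sup>+(r::real). 0 \<partial>lborel)"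
      using AE_lborel_singleton[of 0] True
      by (intro nn_integral_cong_AE) (auto elim!: eventually_mono simp: indicator_def)
    moreover have "(\<integral>\<^sup>+x. f (x\<^sup>2) * ennreal (2 * x) * indicator {0..real N} x \<partial>lborel) = (\<integral>\<^sup>+(x::real). 0 \<partial>lborel)"
      using AE_lborel_singleton[of 0] True
      by (intro nn_integral_cong_AE) (auto elim!: eventually_mono simp: indicator_def)
    ultimately show ?thesis by (simp only:)
  next
    case False
    have d: "((\<lambda>x. x\<^sup>2) has_real_derivative 2 * x) (at x)" for x :: real
      by (auto intro!: derivative_eq_intros)
    have "(\<integral>\<^sup>+r. f r * indicator {0\<^sup>2..(real N)\<^sup>2} r \<partial>lborel)
        = (\<integral>\<^sup>+x. f (x\<^sup>2) * ennreal (2 * x) * indicator {0..real N} x \<partial>lborel)"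
      by (rule nn_integral_substitution_aux[OF assms _ d]) (use False in \<open>auto intro!: continuous_intros\<close>)
    then show ?thesis by simp
  qed
  ultimately have "(\<integral>\<^sup>+r. f r * indicator {0..} r \<partial>lborel) = (\<integral>\<^sup>+x. f (x\<^sup>2) * ennreal (2 * x) * indicator {0..} x \<partial>lborel)"
    by (simp add: LIMSEQ_unique)
  also have "(\<integral>\<^sup>+r. f r * indicator {0..} r \<partial>lborel) = (\<integral>\<^sup>+r. f r * indicator {0<..} r \<partial>lborel)"
    using AE_lborel_singleton[of 0]
    by (intro nn_integral_cong_AE) (auto elim!: eventually_mono simp: indicator_def)
  also have "(\<integral>\<^sup>+x. f (x\<^sup>2) * ennreal (2 * x) * indicator {0..} x \<partial>lborel) = (\<integral>\<^sup>+x. f (x\<^sup>2) * ennreal (2 * x) * indicator {0<..} x \<partial>lborel)"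
    by (intro nn_integral_cong) (auto simp: indicator_def not_less)
  finally show ?thesis .
qed

lemma measurable_cis [measurable]:
  "f \<in> borel_measurable M \<Longrightarrow> (\<lambda>x. cis (f x)) \<in> borel_measurable M"
  unfolding cis_conv_exp by measurable

lemma nn_integral_polar_measure:
  fixes f :: "complex \<Rightarrow> ennreal"
  assumes [measurable]: "f \<in> borel_measurable borel"
  shows "(\<integral>\<^sup>+z. f z \<partial>polar_measure) = (\<integral>\<^sup>+\<rho>. ennreal (\<rho> / (2 * pi)) * indicator {0<..} \<rho> *
    (\<integral>\<^sup>+\<theta>. f (complex_of_real \<rho> * cis \<theta>) * indicator {0..<2 * pi} \<theta> \<partial>lborel) \<partial>lborel)"
proof -
  have "(\<integral>\<^sup>+z. f z \<partial>polar_measure) = (\<integral>\<^sup>+(\<rho>, \<theta>). ennreal (\<rho> / (2 * pi)) * indicator {0<..} \<rho>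
      * (f (complex_of_real \<rho> * cis \<theta>) * indicator {0..<2 * pi} \<theta>) \<partial>(lborel \<Otimes>\<^sub>M lborel))"
    unfolding polar_measure_def lborel_prod[symmetric] indicator_times
    by (simp add: nn_integral_distr nn_integral_density split_beta' mult_ac)
  also have "\<dots> = (\<integral>\<^sup>+\<rho>. \<integral>\<^sup>+\<theta>. ennreal (\<rho> / (2 * pi)) * indicator {0<..} \<rho> * (f (complex_of_real \<rho> * cis \<theta>) * indicator {0..<2 * pi} \<theta>) \<partial>lborel \<partial>lborel)"
    by (subst lborel.nn_integral_fst[symmetric]) simp_all
  also have "\<dots> = (\<integral>\<^sup>+\<rho>. ennreal (\<rho> / (2 * pi)) * indicator {0<..} \<rho> *
    (\<integral>\<^sup>+\<theta>. f (complex_of_real \<rho> * cis \<theta>) * indicator {0..<2 * pi} \<theta> \<partial>lborel) \<partial>lborel)"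
    by (intro nn_integral_cong nn_integral_cmult) measurable
  finally show ?thesis .
qed

lemma norm_orthonormal_basis:
  assumes "orthonormal_basis \<psi>"
  shows "norm (\<psi> n) = 1"
proof -
  have "cinner (\<psi> n) (\<psi> n) = 1"
    using assms by (simp add: orthonormal_basis_def)
  then have "complex_of_real ((norm (\<psi> n))\<^sup>2) = 1"
    by (simp only: cinner_self)
  then show ?thesis
    using norm_ge_zero[of "\<psi> n"] by (simp only: of_real_eq_1_iff power2_eq_1_iff) linarith
qed

definition coherent_coeff :: "real \<Rightarrow> real \<Rightarrow> nat \<Rightarrow> real" where
  "coherent_coeff \<gamma> \<sigma> n = sqrt (fact n / pochhammer (2 * \<gamma>) n) / pochhammer (\<sigma> + 1) n"

context
  fixes \<gamma> \<sigma> :: real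
  assumes \<gamma>: "\<gamma> > 0" and \<sigma>: "\<sigma> > -1"
begin

lemma coherent_coeff_pos: "coherent_coeff \<gamma> \<sigma> n > 0"
  using \<gamma> \<sigma> by (simp add: coherent_coeff_def pochhammer_pos)

lemma coherent_coeff_power2:
  "(coherent_coeff \<gamma> \<sigma> n)\<^sup>2 = fact n / (pochhammer (2 * \<gamma>) n * (pochhammer (\<sigma> + 1) n)\<^sup>2)"
  using \<gamma> pochhammer_pos[of "2 * \<gamma>" n] by (simp add: coherent_coeff_def power_divide)

lemma summable_coherent_coeff:
  assumes "r \<ge> 0"
  shows "summable (\<lambda>n. coherent_coeff \<gamma> \<sigma> n * r ^ n)"
proof -
  let ?a = "coherent_coeff \<gamma> \<sigma>"
  \<comment> \<open>(1 + n) / (2\<gamma> + n) is monotone in n, from 1 / (2\<gamma>) at n = 0 to the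
    limit 1, so the larger of the two bounds it. N is then taken so large that the ratio of
    consecutive terms is at most 1 / 2.\<close>
  define K where "K = sqrt (max 1 (1 / (2 * \<gamma>)))"
  obtain N :: nat where N: "2 * K * r < N" using reals_Archimedean2 by blast
  show ?thesis
  proof (rule summable_ratio_test[of "1/2" "Suc N"])
    fix n :: nat assume n: "n \<ge> Suc N"
    have "(1 + real n) / (2 * \<gamma> + real n) \<le> max 1 (1 / (2 * \<gamma>))"
    proof (cases "2 * \<gamma> \<ge> 1")
      case True
      then have "(1 + real n) / (2 * \<gamma> + real n) \<le> 1" using \<gamma> by simp
      then show ?thesis by simp
    next
      case False
      then have "real n * (2 * \<gamma>) \<le> real n * 1" by (intro mult_left_mono) auto
      then have "(1 + real n) / (2 * \<gamma> + real n) \<le> 1 / (2 * \<gamma>)" using \<gamma> by (simp add: field_simps)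
      then show ?thesis by simp
    qed
    then have K: "sqrt ((1 + real n) / (2 * \<gamma> + real n)) \<le> K"
      unfolding K_def by (rule real_sqrt_le_mono)
    have pos: "\<sigma> + 1 + real n > 0" using \<sigma> by simp
    have "?a (Suc n) = ?a n * (sqrt ((1 + real n) / (2 * \<gamma> + real n)) / (\<sigma> + 1 + real n))"
      by (simp add: coherent_coeff_def pochhammer_Suc real_sqrt_mult real_sqrt_divide mult_ac)
    then have "?a (Suc n) * r ^ Suc n = (?a n * r ^ n) * (sqrt ((1 + real n) / (2 * \<gamma> + real n)) * r / (\<sigma> + 1 + real n))"
      by simp
    also have "\<dots> \<le> (?a n * r ^ n) * (1 / 2)"
    proof (rule mult_left_mono)
      have "sqrt ((1 + real n) / (2 * \<gamma> + real n)) * r \<le> K * r"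
        using K assms by (rule mult_right_mono)
      also have "\<dots> \<le> (\<sigma> + 1 + real n) / 2"
        using N n \<sigma> by simp
      finally show "sqrt ((1 + real n) / (2 * \<gamma> + real n)) * r / (\<sigma> + 1 + real n) \<le> 1 / 2"
        using pos by (simp add: field_simps)
    qed (use assms coherent_coeff_pos[of n] in simp)
    finally show "norm (?a (Suc n) * r ^ Suc n) \<le> 1 / 2 * norm (?a n * r ^ n)"
      using assms coherent_coeff_pos[of n] coherent_coeff_pos[of "Suc n"]
      by (simp add: abs_mult less_imp_le mult.commute)
  qed simp
qed

text \<open>Since (1)_n = n!, the coefficient of x^n in the 2F3 series is the square of
  \<open>coherent_coeff\<close>. Convergence comes from squaring the absolutely convergent series at
  \<open>sqrt x\<close>.\<close>

lemma coherent_N_sums: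
  assumes "x \<ge> 0"
  shows "(\<lambda>n. (coherent_coeff \<gamma> \<sigma> n)\<^sup>2 * x ^ n) sums coherent_N \<gamma> \<sigma> x"
proof -
  have "summable (\<lambda>n. cmod (of_real (coherent_coeff \<gamma> \<sigma> n * sqrt x ^ n)))"
    using summable_coherent_coeff[of "sqrt x"] assms coherent_coeff_pos
    by (simp add: norm_mult norm_power less_imp_le)
  from summable_norm_power2[OF this]
  have "summable (\<lambda>n. (coherent_coeff \<gamma> \<sigma> n)\<^sup>2 * x ^ n)"
    using assms by (simp add: power_mult_distrib norm_mult norm_power flip: power_mult) 
      (simp add: power_mult mult.commute[of _ 2])
  moreover have "pochhammer 1 n * pochhammer 1 n / (pochhammer (2 * \<gamma>) n * pochhammer (\<sigma> + 1) n * pochhammer (\<sigma> + 1) n)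
      * (x ^ n / fact n) = (coherent_coeff \<gamma> \<sigma> n)\<^sup>2 * x ^ n" for n
    unfolding coherent_coeff_power2 by (simp add: power2_eq_square flip: pochhammer_fact)
  ultimately show ?thesis
    by (simp add: coherent_N_def hypergeometric_2F3_def summable_sums)
qed

lemma coherent_N_pos:
  assumes "x \<ge> 0"
  shows "coherent_N \<gamma> \<sigma> x > 0"
proof -
  have "(\<Sum>n\<in>{0}. (coherent_coeff \<gamma> \<sigma> n)\<^sup>2 * x ^ n) \<le> (\<Sum>n. (coherent_coeff \<gamma> \<sigma> n)\<^sup>2 * x ^ n)"
    using assms by (intro sum_le_suminf sums_summable[OF coherent_N_sums[OF assms]]) auto
  also have "\<dots> = coherent_N \<gamma> \<sigma> x"
    using coherent_N_sums[OF assms] by (rule sums_unique[symmetric])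
  finally have "(\<Sum>n\<in>{0}. (coherent_coeff \<gamma> \<sigma> n)\<^sup>2 * x ^ n) \<le> coherent_N \<gamma> \<sigma> x" .
  then show ?thesis by (simp add: coherent_coeff_def)
qed

text \<open>The series of the state converges absolutely in norm, so the continuous inner product
  passes through it. Conjugation in the first argument turns \<open>cnj z\<close> into z, leaving a
  power series in z.\<close>

lemma cinner_coherent_state:
  assumes "orthonormal_basis \<psi>"
  shows "cinner (coherent_state \<psi> \<gamma> \<sigma> z) h = of_real (coherent_N \<gamma> \<sigma> ((cmod z)\<^sup>2) powr (- 1 / 2))
    * (\<Sum>n. of_real (coherent_coeff \<gamma> \<sigma> n) * z ^ n * cinner (\<psi> n) h)"
proof -
  let ?c = "\<lambda>n. complex_of_real (coherent_coeff \<gamma> \<sigma> n) * cnj z ^ n"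
  note norm_\<psi> = norm_orthonormal_basis[OF assms]
  have "summable (\<lambda>n. norm (?c n *\<^sub>C \<psi> n))"
    using summable_coherent_coeff[of "cmod z"] coherent_coeff_pos
    by (simp add: norm_scaleC norm_\<psi> norm_mult norm_power less_imp_le)
  then have sm: "summable (\<lambda>n. ?c n *\<^sub>C \<psi> n)"
    by (rule summable_norm_cancel)
  have st: "coherent_state \<psi> \<gamma> \<sigma> z = (coherent_N \<gamma> \<sigma> ((cmod z)\<^sup>2) powr (- 1 / 2)) *\<^sub>R (\<Sum>n. ?c n *\<^sub>C \<psi> n)"
    by (simp add: coherent_state_def coherent_coeff_def)
  have "cinner h (\<Sum>n. ?c n *\<^sub>C \<psi> n) = (\<Sum>n. cinner h (?c n *\<^sub>C \<psi> n))"
    by (rule bounded_linear.suminf[OF bounded_linear_cinner_right sm])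
  moreover have "cnj (\<Sum>n. cinner h (?c n *\<^sub>C \<psi> n)) = (\<Sum>n. cnj (cinner h (?c n *\<^sub>C \<psi> n)))"
    by (rule bounded_linear.suminf[OF bounded_linear_cnj bounded_linear.summable[OF bounded_linear_cinner_right sm]])
  moreover have "cnj (cinner h (?c n *\<^sub>C \<psi> n)) = of_real (coherent_coeff \<gamma> \<sigma> n) * z ^ n * cinner (\<psi> n) h" for n
    by (simp add: cinner_scaleC_right cinner_commute[of h])
  ultimately show ?thesis
    unfolding st cinner_commute[of _ h] by (simp add: cinner_scaleR_right)
qed

end

text \<open>By (x)_n = Gamma (x + n) / Gamma x, the squared coefficients are the reciprocals of the
  moments of G up to a factor independent of n. This factor is the origin of the Gamma values in the
  constant of the measure.\<close>

lemma coherent_moment: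
  assumes \<gamma>: "\<gamma> > 0" and \<sigma>: "\<sigma> > -1"
  shows "(coherent_coeff \<gamma> \<sigma> n)\<^sup>2 / (Gamma (2 * \<gamma>) * (Gamma (\<sigma> + 1))\<^sup>2)
    * (Gamma (2 * \<gamma> + n) * (Gamma (\<sigma> + n + 1))\<^sup>2 / Gamma (real n + 1)) = 1"
proof -
  have "x \<notin> \<int>\<^sub>\<le>\<^sub>0" if "x > 0" for x :: real
    using that by (auto elim!: nonpos_Ints_cases)
  then have poch: "pochhammer x n = Gamma (x + n) / Gamma x" if "x > 0" for x :: real
    using pochhammer_Gamma[of x n] that by simp
  define X where "X = Gamma (2 * \<gamma>)"
  define Y where "Y = Gamma (2 * \<gamma> + n)"
  define S where "S = Gamma (\<sigma> + 1)"
  define T where "T = Gamma (\<sigma> + n + 1)"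
  have pos: "X > 0" "Y > 0" "S > 0" "T > 0"
    unfolding X_def Y_def S_def T_def using \<gamma> \<sigma> by (auto intro!: Gamma_real_pos)
  have fact: "Gamma (real n + 1) = fact n"
    using Gamma_fact[of n, where ?'a = real] by (simp add: add.commute)
  have poch: "pochhammer (2 * \<gamma>) n = Y / X" "pochhammer (\<sigma> + 1) n = T / S"
    using poch[of "2 * \<gamma>"] poch[of "\<sigma> + 1"] \<gamma> \<sigma>
    by (simp_all add: X_def Y_def S_def T_def add_ac)
  have "(coherent_coeff \<gamma> \<sigma> n)\<^sup>2 / (X * S\<^sup>2) * (Y * T\<^sup>2 / Gamma (real n + 1)) = 1"
    unfolding coherent_coeff_power2[OF \<gamma> \<sigma>] poch fact using pos by (simp add: field_simps)
  then show ?thesis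
    by (simp only: X_def Y_def S_def T_def)
qed

section \<open>The weight and the resolution of the identity\<close>

lemma meijer_weight_exists:
  assumes param: "(\<gamma>, \<sigma>) \<in> ({0<..} \<times> {-1<..0}) \<union> ({0<..1/2} \<times> {-1<..})"
    and c: "c > Max {- (2 * \<gamma> - 1), - \<sigma>, - \<sigma>}"
  obtains g :: "real \<Rightarrow> real" where "g \<in> borel_measurable borel" "\<And>r. g r \<ge> 0" "\<And>r. r \<le> 0 \<Longrightarrow> g r = 0"
    "\<And>r. r > 0 \<Longrightarrow> meijer_G3013 c 0 (of_real (2 * \<gamma> - 1)) (of_real \<sigma>) (of_real \<sigma>) r = complex_of_real (g r)"
    "\<And>n. (\<integral>\<^sup>+r. ennreal (g r * r ^ n) \<partial>lborel)
       = ennreal (Gamma (2 * \<gamma> + n) * (Gamma (\<sigma> + n + 1))\<^sup>2 / Gamma (real n + 1))"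
proof -
  have c: "c > 1 - 2 * \<gamma>" "c > - \<sigma>"
    using c by auto
  \<comment> \<open>The parameter -\<alpha> is \<sigma> if \<sigma> \<le> 0 and 2\<gamma> - 1
    otherwise; p is the other of the two. Since \<sigma> occurs twice in G, the third factor always
    has parameter \<sigma>.\<close>
  define \<alpha> where "\<alpha> = (if \<sigma> \<le> 0 then - \<sigma> else 1 - 2 * \<gamma>)"
  define p where "p = (if \<sigma> \<le> 0 then 2 * \<gamma> - 1 else \<sigma>)"
  have \<alpha>: "0 \<le> \<alpha>" "\<alpha> < 1" "\<alpha> < c" and p: "p > -1" "c + p > 0" and \<sigma>: "\<sigma> > -1" "c + \<sigma> > 0"
    using param c by (auto simp: \<alpha>_def p_def)
  obtain g where g: "g \<in> borel_measurable borel" "\<And>r. g r \<ge> 0" "\<And>r. r \<le> 0 \<Longrightarrow> g r = 0"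
    and inv: "\<And>r. r > 0 \<Longrightarrow> (LINT t|lborel. Gamma (of_real p + Complex c t) * Gamma (of_real \<sigma> + Complex c t)
        * (Gamma (Complex c t - of_real \<alpha>) / Gamma (Complex c t)) * mpow r (- Complex c t))
       = complex_of_real (2 * pi * g r)"
    and mom: "\<And>n. (\<integral>\<^sup>+r. ennreal (g r * r ^ n) \<partial>lborel)
       = ennreal (Gamma (p + n + 1) * Gamma (\<sigma> + n + 1) * (Gamma (real n + 1 - \<alpha>) / Gamma (real n + 1)))"
    using meijer_density_exists[OF \<alpha> p \<sigma>] by blast
  show thesis
  proof (rule that[OF g])
    show "(\<integral>\<^sup>+r. ennreal (g r * r ^ n) \<partial>lborel)
       = ennreal (Gamma (2 * \<gamma> + n) * (Gamma (\<sigma> + n + 1))\<^sup>2 / Gamma (real n + 1))" for n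
    proof -
      have "Gamma (p + real n + 1) * Gamma (real n + 1 - \<alpha>) = Gamma (2 * \<gamma> + real n) * Gamma (\<sigma> + real n + 1)"
        by (simp add: p_def \<alpha>_def algebra_simps)
      then have "Gamma (p + real n + 1) * Gamma (\<sigma> + real n + 1) * (Gamma (real n + 1 - \<alpha>) / Gamma (real n + 1))
        = Gamma (2 * \<gamma> + real n) * (Gamma (\<sigma> + real n + 1))\<^sup>2 / Gamma (real n + 1)"
        by (simp add: power2_eq_square mult_ac)
      then show ?thesis unfolding mom by (simp only:)
    qed
    fix r :: real assume r: "r > 0"
    \<comment> \<open>The \<i> of ds = \<i> dt is kept in front, to cancel against 1 / (2 pi \<i>);
      the Gamma factors are regrouped so that the one with -\<alpha> stands over Gamma s.\<close>
    have "(let s = Complex c t in Gamma (of_real (2 * \<gamma> - 1) + s) * Gamma (of_real \<sigma> + s) * Gamma (of_real \<sigma> + s) / Gamma (0 + s)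
              * complex_of_real r powr (- s) * \<i>)
      = \<i> * (Gamma (of_real p + Complex c t) * Gamma (of_real \<sigma> + Complex c t)
        * (Gamma (Complex c t - of_real \<alpha>) / Gamma (Complex c t)) * mpow r (- Complex c t))" for t
    proof -
      have "Gamma (of_real p + Complex c t) * Gamma (Complex c t - of_real \<alpha>)
          = Gamma (of_real (2 * \<gamma> - 1) + Complex c t) * Gamma (of_real \<sigma> + Complex c t)"
        by (simp add: p_def \<alpha>_def algebra_simps)
      then show ?thesis using r
        by (simp add: Let_def mpow_def mult_ac)
    qed
    then have "meijer_G3013 c 0 (of_real (2 * \<gamma> - 1)) (of_real \<sigma>) (of_real \<sigma>) r
      = 1 / (2 * of_real pi * \<i>) * (\<i> * complex_of_real (2 * pi * g r))"
      unfolding meijer_G3013_def by (simp only: integral_mult_right_zero inv[OF r])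
    then show "meijer_G3013 c 0 (of_real (2 * \<gamma> - 1)) (of_real \<sigma>) (of_real \<sigma>) r = complex_of_real (g r)"
      by simp
  qed
qed

text \<open>The first conjunct certifies that \<open>Re\<close> and \<open>ennreal\<close> in
  \<open>coherent_measure\<close> change nothing away from the origin, and the origin is null for
  the polar measure, which is carried by \<rho> > 0.\<close>

theorem proposition3p2p1:
  fixes \<gamma> \<sigma> c :: real and \<psi> :: "nat \<Rightarrow> 'a::complex_hilbert_space"
  assumes "(\<gamma>, \<sigma>) \<in> ({0<..} \<times> {-1<..0}) \<union> ({0<..1/2} \<times> {-1<..})"
    and "orthonormal_basis \<psi>"
    and "c > Max {- (2 * \<gamma> - 1), - \<sigma>, - \<sigma>}"
  shows "(\<forall>z. z \<noteq> 0 \<longrightarrow> coherent_weight c \<gamma> \<sigma> z \<in> \<real>\<^sub>\<ge>\<^sub>0)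
    \<and> resolution_of_identity (coherent_measure c \<gamma> \<sigma>) (coherent_state \<psi> \<gamma> \<sigma>)"
proof -
  have \<gamma>: "\<gamma> > 0" and \<sigma>: "\<sigma> > -1" using assms(1) by auto
  obtain g :: "real \<Rightarrow> real" where [measurable]: "g \<in> borel_measurable borel"
    and g_nonneg: "\<And>r. g r \<ge> 0" and g_nonpos: "\<And>r. r \<le> 0 \<Longrightarrow> g r = 0"
    and G: "\<And>r. r > 0 \<Longrightarrow> meijer_G3013 c 0 (of_real (2 * \<gamma> - 1)) (of_real \<sigma>) (of_real \<sigma>) r = complex_of_real (g r)"
    and mom: "\<And>n. (\<integral>\<^sup>+r. ennreal (g r * r ^ n) \<partial>lborel)
       = ennreal (Gamma (2 * \<gamma> + n) * (Gamma (\<sigma> + n + 1))\<^sup>2 / Gamma (real n + 1))"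
    using meijer_weight_exists[OF assms(1,3)] by blast
  let ?a = "coherent_coeff \<gamma> \<sigma>"
  define C where "C = 1 / (Gamma (2 * \<gamma>) * (Gamma (\<sigma> + 1))\<^sup>2)"
  have C: "C > 0" unfolding C_def using \<gamma> \<sigma>
    by (intro divide_pos_pos mult_pos_pos zero_less_power Gamma_real_pos) auto
  have W: "coherent_weight c \<gamma> \<sigma> z = complex_of_real (2 * C * coherent_N \<gamma> \<sigma> ((cmod z)\<^sup>2) * g ((cmod z)\<^sup>2))" if "z \<noteq> 0" for z
    using G[of "(cmod z)\<^sup>2"] that by (simp add: coherent_weight_def C_def coherent_N_def)
  have N_pos: "coherent_N \<gamma> \<sigma> ((cmod z)\<^sup>2) > 0" for z
    by (rule coherent_N_pos[OF \<gamma> \<sigma>]) simp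
  have "coherent_weight c \<gamma> \<sigma> z \<in> \<real>\<^sub>\<ge>\<^sub>0" if "z \<noteq> 0" for z
    unfolding W[OF that] nonneg_Reals_of_real_iff using C N_pos[of z] g_nonneg
    by (intro mult_nonneg_nonneg) auto
  moreover have "resolution_of_identity (coherent_measure c \<gamma> \<sigma>) (coherent_state \<psi> \<gamma> \<sigma>)"
  proof (rule resolution_of_identity_if_norm)
    fix h :: 'a
    let ?v = "coherent_state \<psi> \<gamma> \<sigma>"
    define b where "b = (\<lambda>n. cinner (\<psi> n) h)"
    define P where "P = (\<lambda>z. \<Sum>n. of_real (?a n) * z ^ n * b n)"
    have [measurable]: "P \<in> borel_measurable borel"
      unfolding P_def by measurable
    have N_eq: "coherent_N \<gamma> \<sigma> ((cmod z)\<^sup>2) = (\<Sum>n. (?a n)\<^sup>2 * ((cmod z)\<^sup>2) ^ n)" for z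
      by (rule sums_unique[OF coherent_N_sums[OF \<gamma> \<sigma>]]) simp
    have [measurable]: "(\<lambda>z. coherent_N \<gamma> \<sigma> ((cmod z)\<^sup>2)) \<in> borel_measurable borel"
      unfolding N_eq by measurable
    have v: "(cmod (cinner (?v z) h))\<^sup>2 = (cmod (P z))\<^sup>2 / coherent_N \<gamma> \<sigma> ((cmod z)\<^sup>2)" for z
    proof -
      have "(coherent_N \<gamma> \<sigma> ((cmod z)\<^sup>2) powr (- 1 / 2))\<^sup>2 = coherent_N \<gamma> \<sigma> ((cmod z)\<^sup>2) powr (- 1)"
        by (simp add: power2_eq_square flip: powr_add)
      also have "\<dots> = 1 / coherent_N \<gamma> \<sigma> ((cmod z)\<^sup>2)"
        using N_pos[of z] by (simp add: powr_minus divide_inverse)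
      finally show ?thesis
        by (simp add: cinner_coherent_state[OF \<gamma> \<sigma> assms(2)] P_def b_def norm_mult power_mult_distrib)
    qed
    \<comment> \<open>The formula \<open>W\<close> covers z \<noteq> 0 only; at the origin the
      weight is some constant, which keeps the piecewise function Borel.\<close>
    have W_meas [measurable]: "(\<lambda>z. Re (coherent_weight c \<gamma> \<sigma> z)) \<in> borel_measurable borel"
    proof -
      have "(\<lambda>z. Re (coherent_weight c \<gamma> \<sigma> z)) = (\<lambda>z. if z = 0 then Re (coherent_weight c \<gamma> \<sigma> 0)
          else 2 * C * coherent_N \<gamma> \<sigma> ((cmod z)\<^sup>2) * g ((cmod z)\<^sup>2))"
        using W by auto
      also have "\<dots> \<in> borel_measurable borel" by measurable
      finally show ?thesis .
    qed
    have v_meas [measurable]: "(\<lambda>z. (cmod (cinner (?v z) h))\<^sup>2) \<in> borel_measurable borel"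
      unfolding v by measurable
    have sets_polar [measurable_cong]: "sets polar_measure = sets borel"
      by (simp add: polar_measure_def)
    have norm_\<psi>: "norm (\<psi> n) = 1" for n
      by (rule norm_orthonormal_basis[OF assms(2)])
    \<comment> \<open>At fixed radius the normalization of the state cancels the 2F3 factor of the
      weight. What is left is g times the squared modulus of a Fourier series in \<theta>.\<close>
    have circle: "(\<integral>\<^sup>+\<theta>. ennreal (Re (coherent_weight c \<gamma> \<sigma> (of_real \<rho> * cis \<theta>))) *
          ennreal ((cmod (cinner (?v (of_real \<rho> * cis \<theta>)) h))\<^sup>2) * indicator {0..<2 * pi} \<theta> \<partial>lborel)
        = ennreal (2 * C * g (\<rho>\<^sup>2)) * (ennreal (2 * pi) * (\<Sum>n. ennreal ((?a n * \<rho> ^ n * cmod (b n))\<^sup>2)))"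
      if \<rho>: "\<rho> > 0" for \<rho>
    proof -
      let ?c = "\<lambda>n. of_real (?a n * \<rho> ^ n) * b n"
      have "summable (\<lambda>n. ?a n * \<rho> ^ n * norm h)"
        using \<rho> by (intro summable_mult2 summable_coherent_coeff[OF \<gamma> \<sigma>]) simp
      then have "summable (\<lambda>n. cmod (?c n))"
      proof (rule summable_comparison_test'[where N = 0])
        show "norm (cmod (?c n)) \<le> ?a n * \<rho> ^ n * norm h" for n
          using norm_cinner_le[of "\<psi> n" h] \<rho> coherent_coeff_pos[OF \<gamma> \<sigma>, of n]
          by (simp add: norm_\<psi> b_def norm_mult norm_power mult_left_mono less_imp_le)
      qed
      note circ = circle_parseval[OF this]
      have pt: "ennreal (Re (coherent_weight c \<gamma> \<sigma> (of_real \<rho> * cis \<theta>))) *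
          ennreal ((cmod (cinner (?v (of_real \<rho> * cis \<theta>)) h))\<^sup>2)
        = ennreal (2 * C * g (\<rho>\<^sup>2)) * ennreal ((cmod (\<Sum>n. ?c n * cis (n * \<theta>)))\<^sup>2)" for \<theta> :: real
      proof -
        have nz: "complex_of_real \<rho> * cis \<theta> \<noteq> 0" and cm: "cmod (complex_of_real \<rho> * cis \<theta>) = \<rho>"
          using \<rho> by (simp_all add: norm_mult)
        have "of_real (?a n) * (of_real \<rho> * cis \<theta>) ^ n * b n = ?c n * cis (n * \<theta>)" for n
          unfolding power_mult_distrib Complex.DeMoivre by simp
        then have "P (of_real \<rho> * cis \<theta>) = (\<Sum>n. ?c n * cis (n * \<theta>))"
          unfolding P_def by (simp only:)
        moreover have "ennreal (2 * C * coherent_N \<gamma> \<sigma> (\<rho>\<^sup>2) * g (\<rho>\<^sup>2)) * ennreal (x / coherent_N \<gamma> \<sigma> (\<rho>\<^sup>2))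
            = ennreal (2 * C * g (\<rho>\<^sup>2)) * ennreal x" for x
        proof -
          have "2 * C * coherent_N \<gamma> \<sigma> (\<rho>\<^sup>2) * g (\<rho>\<^sup>2) * (x / coherent_N \<gamma> \<sigma> (\<rho>\<^sup>2)) = 2 * C * g (\<rho>\<^sup>2) * x"
            using coherent_N_pos[OF \<gamma> \<sigma>, of "\<rho>\<^sup>2"] by simp
          moreover have "0 \<le> 2 * C * coherent_N \<gamma> \<sigma> (\<rho>\<^sup>2) * g (\<rho>\<^sup>2)" "0 \<le> 2 * C * g (\<rho>\<^sup>2)"
            using C coherent_N_pos[OF \<gamma> \<sigma>, of "\<rho>\<^sup>2"] g_nonneg[of "\<rho>\<^sup>2"] by simp_all
          ultimately show ?thesis by (simp only: ennreal_mult'[symmetric])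
        qed
        ultimately show ?thesis
          unfolding W[OF nz] v cm Re_complex_of_real by (simp only:)
      qed
      have "(cmod (?c n))\<^sup>2 = (?a n * \<rho> ^ n * cmod (b n))\<^sup>2" for n
        using \<rho> by (simp add: norm_mult norm_power power_mult_distrib)
      then show ?thesis
        unfolding pt using circ
        by (simp add: mult.assoc nn_integral_cmult)
    qed
    have "(\<integral>\<^sup>+z. ennreal ((cmod (cinner (?v z) h))\<^sup>2) \<partial>coherent_measure c \<gamma> \<sigma>)
        = (\<integral>\<^sup>+z. ennreal (Re (coherent_weight c \<gamma> \<sigma> z)) * ennreal ((cmod (cinner (?v z) h))\<^sup>2) \<partial>polar_measure)"
      unfolding coherent_measure_def by (rule nn_integral_density) measurable
    also have "\<dots> = (\<integral>\<^sup>+\<rho>. ennreal (\<rho> / (2 * pi)) * indicator {0<..} \<rho> *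
        (ennreal (2 * C * g (\<rho>\<^sup>2)) * (ennreal (2 * pi) * (\<Sum>n. ennreal ((?a n * \<rho> ^ n * cmod (b n))\<^sup>2)))) \<partial>lborel)"
    proof -
      have "(\<lambda>z. ennreal (Re (coherent_weight c \<gamma> \<sigma> z)) * ennreal ((cmod (cinner (?v z) h))\<^sup>2)) \<in> borel_measurable borel"
        by measurable
      note nn_integral_polar_measure[OF this]
      also have "(\<integral>\<^sup>+\<rho>. ennreal (\<rho> / (2 * pi)) * indicator {0<..} \<rho> *
          (\<integral>\<^sup>+\<theta>. ennreal (Re (coherent_weight c \<gamma> \<sigma> (of_real \<rho> * cis \<theta>))) *
            ennreal ((cmod (cinner (?v (of_real \<rho> * cis \<theta>)) h))\<^sup>2) * indicator {0..<2 * pi} \<theta> \<partial>lborel) \<partial>lborel)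
        = (\<integral>\<^sup>+\<rho>. ennreal (\<rho> / (2 * pi)) * indicator {0<..} \<rho> *
          (ennreal (2 * C * g (\<rho>\<^sup>2)) * (ennreal (2 * pi) * (\<Sum>n. ennreal ((?a n * \<rho> ^ n * cmod (b n))\<^sup>2)))) \<partial>lborel)"
      proof (rule nn_integral_cong)
        fix \<rho> :: real
        show "ennreal (\<rho> / (2 * pi)) * indicator {0<..} \<rho> *
          (\<integral>\<^sup>+\<theta>. ennreal (Re (coherent_weight c \<gamma> \<sigma> (of_real \<rho> * cis \<theta>))) *
            ennreal ((cmod (cinner (?v (of_real \<rho> * cis \<theta>)) h))\<^sup>2) * indicator {0..<2 * pi} \<theta> \<partial>lborel)
          = ennreal (\<rho> / (2 * pi)) * indicator {0<..} \<rho> *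
          (ennreal (2 * C * g (\<rho>\<^sup>2)) * (ennreal (2 * pi) * (\<Sum>n. ennreal ((?a n * \<rho> ^ n * cmod (b n))\<^sup>2))))"
        proof (cases "\<rho> > 0")
          case True
          then show ?thesis by (simp only: circle)
        next
          case False
          then have "(indicator {0<..} \<rho> :: ennreal) = 0" by simp
          then show ?thesis by (simp only: mult_zero_left mult_zero_right)
        qed
      qed
      finally show ?thesis .
    qed
    also have "\<dots> = (\<integral>\<^sup>+\<rho>. (\<Sum>n. ennreal (C * (?a n)\<^sup>2 * (cmod (b n))\<^sup>2) *
        (ennreal (g (\<rho>\<^sup>2) * (\<rho>\<^sup>2) ^ n) * ennreal (2 * \<rho>) * indicator {0<..} \<rho>)) \<partial>lborel)"
    proof (rule nn_integral_cong)
      fix \<rho> :: real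
      show "ennreal (\<rho> / (2 * pi)) * indicator {0<..} \<rho> *
        (ennreal (2 * C * g (\<rho>\<^sup>2)) * (ennreal (2 * pi) * (\<Sum>n. ennreal ((?a n * \<rho> ^ n * cmod (b n))\<^sup>2))))
        = (\<Sum>n. ennreal (C * (?a n)\<^sup>2 * (cmod (b n))\<^sup>2) *
        (ennreal (g (\<rho>\<^sup>2) * (\<rho>\<^sup>2) ^ n) * ennreal (2 * \<rho>) * indicator {0<..} \<rho>))"
      proof (cases "\<rho> > 0")
        case True
        \<comment> \<open>The length 2 pi of the circle cancels the 1 / (2 pi) of the polar measure,
          and the factor 2 of the weight joins \<rho> to form the Jacobian 2\<rho> of r =
          \<rho>^2.\<close>
        have "ennreal (\<rho> / (2 * pi)) * (ennreal (2 * C * g (\<rho>\<^sup>2)) * (ennreal (2 * pi) * ennreal ((?a n * \<rho> ^ n * cmod (b n))\<^sup>2)))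
          = ennreal (C * (?a n)\<^sup>2 * (cmod (b n))\<^sup>2) * (ennreal (g (\<rho>\<^sup>2) * (\<rho>\<^sup>2) ^ n) * ennreal (2 * \<rho>))" for n
        proof -
          have "\<rho> / (2 * pi) * (2 * C * g (\<rho>\<^sup>2) * (2 * pi * (?a n * \<rho> ^ n * cmod (b n))\<^sup>2))
            = C * (?a n)\<^sup>2 * (cmod (b n))\<^sup>2 * (g (\<rho>\<^sup>2) * (\<rho>\<^sup>2) ^ n * (2 * \<rho>))"
            by (simp add: power_mult_distrib power_mult[symmetric] mult.commute)
          then show ?thesis
            using True C g_nonneg[of "\<rho>\<^sup>2"] by (simp add: ennreal_mult[symmetric] less_imp_le)
        qed
        then show ?thesis
          using True by (simp flip: ennreal_suminf_cmult)
      qed simp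
    qed
    also have "\<dots> = (\<Sum>n. \<integral>\<^sup>+\<rho>. ennreal (C * (?a n)\<^sup>2 * (cmod (b n))\<^sup>2) *
        (ennreal (g (\<rho>\<^sup>2) * (\<rho>\<^sup>2) ^ n) * ennreal (2 * \<rho>) * indicator {0<..} \<rho>) \<partial>lborel)"
      by (rule nn_integral_suminf) measurable
    also have "\<dots> = (\<Sum>n. ennreal ((cmod (b n))\<^sup>2))"
    proof (rule arg_cong[where f = suminf], rule ext)
      fix n
      have meas: "(\<lambda>r. ennreal (g r * r ^ n)) \<in> borel_measurable borel"
        by measurable
      have "(\<integral>\<^sup>+\<rho>. ennreal (C * (?a n)\<^sup>2 * (cmod (b n))\<^sup>2) *
          (ennreal (g (\<rho>\<^sup>2) * (\<rho>\<^sup>2) ^ n) * ennreal (2 * \<rho>) * indicator {0<..} \<rho>) \<partial>lborel)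
        = ennreal (C * (?a n)\<^sup>2 * (cmod (b n))\<^sup>2) * (\<integral>\<^sup>+r. ennreal (g r * r ^ n) * indicator {0<..} r \<partial>lborel)"
        unfolding nn_integral_square_substitution[OF meas] by (rule nn_integral_cmult) measurable
      also have "(\<integral>\<^sup>+r. ennreal (g r * r ^ n) * indicator {0<..} r \<partial>lborel) = (\<integral>\<^sup>+r. ennreal (g r * r ^ n) \<partial>lborel)"
        by (intro nn_integral_cong) (auto simp: indicator_def g_nonpos)
      also have "ennreal (C * (?a n)\<^sup>2 * (cmod (b n))\<^sup>2) * \<dots>
        = ennreal ((cmod (b n))\<^sup>2 * ((?a n)\<^sup>2 / (Gamma (2 * \<gamma>) * (Gamma (\<sigma> + 1))\<^sup>2)
          * (Gamma (2 * \<gamma> + n) * (Gamma (\<sigma> + n + 1))\<^sup>2 / Gamma (real n + 1))))"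
      proof -
        have "0 \<le> C * (?a n)\<^sup>2 * (cmod (b n))\<^sup>2" using C by simp
        then show ?thesis
          unfolding mom by (subst ennreal_mult'[symmetric]) (simp_all add: C_def mult_ac)
      qed
      also have "\<dots> = ennreal ((cmod (b n))\<^sup>2)"
        unfolding coherent_moment[OF \<gamma> \<sigma>] by simp
      finally show "(\<integral>\<^sup>+\<rho>. ennreal (C * (?a n)\<^sup>2 * (cmod (b n))\<^sup>2) *
          (ennreal (g (\<rho>\<^sup>2) * (\<rho>\<^sup>2) ^ n) * ennreal (2 * \<rho>) * indicator {0<..} \<rho>) \<partial>lborel)
        = ennreal ((cmod (b n))\<^sup>2)" .
    qed
    also have "\<dots> = ennreal ((norm h)\<^sup>2)"
      using parseval[OF assms(2), of h] unfolding b_def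
      by (intro sums_unique[symmetric] sums_ennreal[THEN iffD2]) auto
    \<comment> \<open>A nonnegative measurable function with finite extended integral is integrable,
      with that value.\<close>
    finally show "has_bochner_integral (coherent_measure c \<gamma> \<sigma>) (\<lambda>z. (cmod (cinner (?v z) h))\<^sup>2) ((norm h)\<^sup>2)"
      by (intro has_bochner_integral_nn_integral) (auto simp: coherent_measure_def sets_polar)
  qed
  ultimately show ?thesis by blast
qed

end
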